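(* Let $\bar H\in C^{\infty}(S^{2})$ and let $\imath\colon S^{2}\hookrightarrow\mathbb{R}^{3}$ be the natural inclusion of the unit sphere. Let $H\in C^{\infty}(\mathbb{R}^{3})$ be an extension of $\bar H$, i.e. $\imath^{*}H=\bar H$. Let $\Phi_h$ be a symplectic Runge--Kutta method and let $\varphi_h(H)\colon\mathbb{R}^3\to\mathbb{R}^3$ be the map to which $\Phi_h(X_{\pi^{*}H})$ descends, i.e. $\varphi_h(H)\circ\pi=\pi\circ\Phi_h(X_{\pi^{*}H})$. Then $\varphi_h(H)$ induces a volume preserving integrator $\bar\varphi_h(\bar H)\colon S^2\to S^2$ for $X_{\bar H}$ by $\imath\circ\bar\varphi_h(\bar H)=\varphi_h(H)\circ\imath$.
   Context: The map $\pi\colon T^{*}\mathbb{R}^{2}\to\mathbb{R}^{3}$ is $\pi(q_1,q_2,p_1,p_2)=\frac14(2q_1q_2+2p_1p_2,\;2q_1p_2-2q_2p_1,\;q_1^2+p_1^2-q_2^2-p_2^2)$, and $\pi^*H:=H\circ\pi$. $\mathbb{R}^3$ carries the rigid body bracket $\{F,H\}(\boldsymbol w):=-\boldsymbol w\cdot(\nabla F(\boldsymbol w)\times\nabla H(\boldsymbol w))$, with Hamiltonian vector fields $X_H(\boldsymbol w):=\boldsymbol w\times\nabla H(\boldsymbol w)$. Its symplectic leaves (coadjoint orbits) are the spheres centred at the origin and $\{0\}$. The unit sphere $S^2$ has the standard volume form as its symplectic form, and $X_{\bar H}$ is the Hamiltonian vector field on this leaf, i.e. $X_{\bar H}(\boldsymbol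 w)=\boldsymbol w\times\nabla H(\boldsymbol w)$ for $\boldsymbol w\in S^2$ and any smooth extension $H$ of $\bar H$. $T^{*}\mathbb{R}^2\cong\mathbb{R}^4$ carries the canonical symplectic structure, with the sign of the Hamiltonian vector field chosen so that $\pi$ is a Poisson map: $X_K$ is given by $\dot q_i=-\partial K/\partial p_i$, $\dot p_i=\partial K/\partial q_i$. Runge--Kutta methods: for coefficients $(a_{ij},b_i)$ with $\sum_i b_i=1$, the method with step size $h$ applied to a vector field $X$ on a vector space is the map $\Phi_h(X)\colon z\mapsto z+h\sum_i b_iX(Y_i)$, where $Y_i=z+h\sum_j a_{ij}X(Y_j)$. It is understood that $h$ is such that the stage equations define this map, via the solution branching smoothly from $Y_i=z$ at $h=0$. The method is symplectic if $\Phi_h(X_K)$ is a symplectic map for every Hamiltonian $K$ on a symplectic vector space (for irreducible methods: $b_ia_{ij}+b_ja_{ji}=b_ib_j$). An integrator for a vector field $X$ is a family of maps that agrees with the time-$h$ flow of $X$ up to $\mathcal O(h^{k+1})$ as $h\to 0$, for some $k\ge1$. *)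

theory Defs
  imports "HOL-Analysis.Analysis"
begin

section \<open>Smooth functions\<close>

text \<open>For open \<open>S\<close> in a finite-dimensional space, \<open>Ck_on k S f\<close> says that \<open>f\<close> is of class
  \<open>C\<^sup>k\<close> on \<open>S\<close>; the derivative is handled through its values on fixed directions.\<close>

primrec Ck_on :: "nat \<Rightarrow> 'a::real_normed_vector set \<Rightarrow> ('a \<Rightarrow> 'b::real_normed_vector) \<Rightarrow> bool" where
  "Ck_on 0 S f \<longleftrightarrow> continuous_on S f"
| "Ck_on (Suc k) S f \<longleftrightarrow>
     (\<exists>f'. (\<forall>x\<in>S. (f has_derivative f' x) (at x)) \<and> (\<forall>v. Ck_on k S (\<lambda>x. f' x v)))"

definition smooth_on :: "'a::real_normed_vector set \<Rightarrow> ('a \<Rightarrow> 'b::real_normed_vector) \<Rightarrow> bool" where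
  "smooth_on S f \<longleftrightarrow> (\<forall>k. Ck_on k S f)"

definition grad :: "('a::euclidean_space \<Rightarrow> real) \<Rightarrow> 'a \<Rightarrow> 'a" where
  "grad f x = (\<Sum>b\<in>Basis. frechet_derivative f (at x) b *\<^sub>R b)"


section \<open>Hamiltonian vector fields on symplectic vector spaces\<close>

definition symplectic_form :: "('v::euclidean_space \<Rightarrow> 'v \<Rightarrow> real) \<Rightarrow> bool" where
  "symplectic_form \<omega> \<longleftrightarrow>
     bilinear \<omega> \<and> (\<forall>u. \<omega> u u = 0) \<and> (\<forall>u. (\<forall>v. \<omega> u v = 0) \<longrightarrow> u = 0)"

text \<open>For \<open>\<omega> = \<Sum>\<^sub>i dq\<^sub>i \<and> dp\<^sub>i\<close> this sign convention gives
  \<open>q\<^sub>i' = - \<partial>K/\<partial>p\<^sub>i\<close> and \<open>p\<^sub>i' = \<partial>K/\<partial>q\<^sub>i\<close>.\<close>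

definition hamiltonian_field ::
    "('v::euclidean_space \<Rightarrow> 'v \<Rightarrow> real) \<Rightarrow> ('v \<Rightarrow> real) \<Rightarrow> ('v \<Rightarrow> 'v) \<Rightarrow> bool" where
  "hamiltonian_field \<omega> K X \<longleftrightarrow> (\<forall>z. (K has_derivative (\<lambda>v. \<omega> v (X z))) (at z))"


section \<open>Runge--Kutta methods\<close>

text \<open>The finite type \<open>'s\<close> indexes the stages. \<open>rk_branch A X z h Y\<close> says that \<open>Y\<close> is a
  solution branch of the stage equations along the step sizes between \<open>0\<close> and \<open>h\<close>; the equations
  force \<open>Y 0 i = z\<close>. The last conjunct is the nondegeneracy of the linearized stage equations.
  By the implicit function theorem it makes the branch unique, defined for nearby \<open>z\<close> and \<open>h\<close>,
  and, for smooth \<open>X\<close>, smooth in \<open>(h, z)\<close>.\<close>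

definition rk_branch ::
    "real^'s^'s \<Rightarrow> ('v::euclidean_space \<Rightarrow> 'v) \<Rightarrow> 'v \<Rightarrow> real \<Rightarrow> (real \<Rightarrow> 's::finite \<Rightarrow> 'v) \<Rightarrow> bool" where
  "rk_branch A X z h Y \<longleftrightarrow>
     (\<forall>i. continuous_on (closed_segment 0 h) (\<lambda>t. Y t i)) \<and>
     (\<forall>t\<in>closed_segment 0 h. \<forall>i. Y t i = z + t *\<^sub>R (\<Sum>j\<in>UNIV. A $ i $ j *\<^sub>R X (Y t j))) \<and>
     (\<forall>t\<in>closed_segment 0 h. \<forall>V.
        (\<forall>i. V i = t *\<^sub>R (\<Sum>j\<in>UNIV. A $ i $ j *\<^sub>R frechet_derivative X (at (Y t j)) (V j)))
          \<longrightarrow> (\<forall>i. V i = 0))"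

text \<open>The set of points at which the method with step size \<open>h\<close> is defined, and the map
  \<open>\<Phi>\<^sub>h(X)\<close>, which is meaningful on that set only.\<close>

definition rk_domain :: "real^'s^'s::finite \<Rightarrow> ('v::euclidean_space \<Rightarrow> 'v) \<Rightarrow> real \<Rightarrow> 'v set" where
  "rk_domain A X h = {z. \<exists>Y. rk_branch A X z h Y}"

definition rk_map ::
    "real^'s^'s \<Rightarrow> real^'s::finite \<Rightarrow> ('v::euclidean_space \<Rightarrow> 'v) \<Rightarrow> real \<Rightarrow> 'v \<Rightarrow> 'v" where
  "rk_map A b X h z =
     (let Y = (SOME Y. rk_branch A X z h Y) in z + h *\<^sub>R (\<Sum>i\<in>UNIV. b $ i *\<^sub>R X (Y h i)))"

text \<open>A type cannot be quantified inside a formula, so the underlying vector space \<open>'v\<close> is a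
  parameter; all symplectic forms on it are considered.\<close>

definition symplectic_rk ::
    "'v::euclidean_space itself \<Rightarrow> real^'s^'s \<Rightarrow> real^'s::finite \<Rightarrow> bool" where
  "symplectic_rk _ A b \<longleftrightarrow>
     (\<forall>(\<omega> :: 'v \<Rightarrow> 'v \<Rightarrow> real) K X h.
        symplectic_form \<omega> \<and> smooth_on UNIV K \<and> hamiltonian_field \<omega> K X \<longrightarrow>
        (\<forall>z\<in>rk_domain A X h. \<exists>D. (rk_map A b X h has_derivative D) (at z) \<and>
           (\<forall>u v. \<omega> (D u) (D v) = \<omega> u v)))"


section \<open>The map from the cotangent bundle of the plane to three-space\<close>

type_synonym cotangent_plane = "(real^2) \<times> (real^2)"

definition canonical_field :: "(cotangent_plane \<Rightarrow> real) \<Rightarrow> cotangent_plane \<Rightarrow> cotangent_plane" where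
  "canonical_field K z = (- snd (grad K z), fst (grad K z))"

definition hopf :: "cotangent_plane \<Rightarrow> real^3" where
  "hopf = (\<lambda>(q, p). (1/4) *\<^sub>R vector
     [2 * q$1 * q$2 + 2 * p$1 * p$2,
      2 * q$1 * p$2 - 2 * q$2 * p$1,
      (q$1)\<^sup>2 + (p$1)\<^sup>2 - (q$2)\<^sup>2 - (p$2)\<^sup>2])"


section \<open>The sphere\<close>

abbreviation S2 :: "(real^3) set" where
  "S2 \<equiv> sphere 0 1"

text \<open>Functions on \<open>S2\<close> and maps from \<open>S2\<close> to \<open>S2\<close> are represented by functions on the ambient
  space of which only the values on \<open>S2\<close> matter.\<close>

definition smooth_on_S2 :: "(real^3 \<Rightarrow> real) \<Rightarrow> bool" where
  "smooth_on_S2 f \<longleftrightarrow>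
     (\<forall>w\<in>S2. \<exists>U F. open U \<and> w \<in> U \<and> smooth_on U F \<and> (\<forall>u\<in>U \<inter> S2. F u = f u))"

definition extends_S2 :: "(real^3 \<Rightarrow> real) \<Rightarrow> (real^3 \<Rightarrow> real) \<Rightarrow> bool" where
  "extends_S2 H f \<longleftrightarrow> smooth_on UNIV H \<and> (\<forall>w\<in>S2. H w = f w)"

text \<open>For \<open>w\<close> in \<open>S2\<close> the vector \<open>w \<times> \<nabla>H(w)\<close> does not depend on the extension \<open>H\<close> of \<open>f\<close>.\<close>

definition hamiltonian_field_S2 :: "(real^3 \<Rightarrow> real) \<Rightarrow> real^3 \<Rightarrow> real^3" where
  "hamiltonian_field_S2 f w = (THE v. \<exists>H. extends_S2 H f \<and> v = cross3 w (grad H w))"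

text \<open>Invariance of the volume form \<open>(u, v) \<mapsto> w \<bullet> (u \<times> v)\<close> on the tangent spaces
  \<open>{u. u \<bullet> w = 0}\<close> under pullback. On tangent vectors a derivative within the sphere is uniquely
  determined, so the choice of \<open>D\<close> is immaterial.\<close>

definition volume_preserving_S2 :: "(real^3 \<Rightarrow> real^3) \<Rightarrow> bool" where
  "volume_preserving_S2 f \<longleftrightarrow>
     (\<forall>w\<in>S2. \<exists>D. (f has_derivative D) (at w within S2) \<and>
        (\<forall>u v. u \<bullet> w = 0 \<and> v \<bullet> w = 0 \<longrightarrow> f w \<bullet> cross3 (D u) (D v) = w \<bullet> cross3 u v))"


section \<open>Integrators\<close>

definition flow_on :: "real \<Rightarrow> 'v::euclidean_space set \<Rightarrow> ('v \<Rightarrow> 'v) \<Rightarrow> (real \<Rightarrow> 'v \<Rightarrow> 'v) \<Rightarrow> bool" where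
  "flow_on \<delta> M X \<psi> \<longleftrightarrow>
     (\<forall>w\<in>M. \<psi> 0 w = w \<and>
        (\<forall>t\<in>{-\<delta>..\<delta>}. \<psi> t w \<in> M \<and>
           ((\<lambda>s. \<psi> s w) has_vector_derivative X (\<psi> t w)) (at t within {-\<delta>..\<delta>})))"

text \<open>Only the limit \<open>h \<rightarrow> 0\<close> matters, so the flow is needed for small times only.\<close>

definition integrator :: "'v::euclidean_space set \<Rightarrow> ('v \<Rightarrow> 'v) \<Rightarrow> (real \<Rightarrow> 'v \<Rightarrow> 'v) \<Rightarrow> bool" where
  "integrator M X \<phi> \<longleftrightarrow>
     (\<exists>k\<ge>1. \<exists>\<delta>>0. \<exists>\<psi> C. flow_on \<delta> M X \<psi> \<and>
        (\<forall>h\<in>{-\<delta>..\<delta>}. \<forall>w\<in>M. norm (\<phi> h w - \<psi> h w) \<le> C * \<bar>h\<bar> ^ (k + 1)))"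


section \<open>Admissible step sizes\<close>

text \<open>When \<open>H\<close> grows fast, the stage equations for \<open>H \<circ> hopf\<close> need not be solvable on the whole
  phase space for any \<open>h \<noteq> 0\<close>. It is enough that they define the map on the preimage of the closed
  unit ball, which is the ball of radius \<open>2\<close>; this holds in particular when they define it
  everywhere.\<close>

definition admissible_step :: "real^'s^'s::finite \<Rightarrow> (real^3 \<Rightarrow> real) \<Rightarrow> real \<Rightarrow> bool" where
  "admissible_step A H h \<longleftrightarrow>
     hopf -` cball 0 1 \<subseteq> rk_domain A (canonical_field (H \<circ> hopf)) h"

end

theory Submission
  imports Defs
begin

text \<open>
  Write \<open>z\<^sub>k = q\<^sub>k + i p\<^sub>k\<close>, and let \<open>J\<close> be multiplication by \<open>i\<close> on both components. The circle acts
  on the cotangent bundle by \<open>z \<mapsto> exp (i \<theta>) z\<close>. This action is linear, isometric and symplectic for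
  \<open>\<omega> u v = J u \<bullet> v\<close>, its moment map is a multiple of \<open>\<bar>z\<bar>\<^sup>2\<close>, and its orbits are the fibres
  of the map \<open>hopf\<close>, which sends the sphere of radius \<open>2\<close> onto \<open>S2\<close>. In other words, \<open>S2\<close>
  with its area form is the symplectic reduction of the cotangent bundle at the level \<open>\<bar>z\<bar> = 2\<close>.

  The Hamiltonian \<open>H \<circ> hopf\<close> is invariant, so its vector field \<open>X\<close> commutes with the action. A
  Runge--Kutta method commutes with linear changes of variables, so the map \<open>\<Phi>\<close> of one step commutes
  with the action too (\<open>rk_map_circle_action\<close>). This needs the solution branch of the stage equations
  to be determined by its defining properties: the set of step sizes at which two branches agree is
  closed, and nondegeneracy of the linearized equations makes it open (\<open>rk_branch_unique\<close>).

  A symplectic map that commutes with the action preserves the moment map up to a constant: from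
  \<open>D\<Phi> (J z) = J (\<Phi> z)\<close> and symplecticity one gets \<open>\<Phi> z \<bullet> D\<Phi> v = z \<bullet> v\<close>, that is, \<open>\<bar>\<Phi> z\<bar>\<^sup>2 - \<bar>z\<bar>\<^sup>2\<close> has
  derivative \<open>0\<close> (\<open>symplectic_equivariant_preserves_norm\<close>). On a ball around \<open>0\<close> this difference is
  therefore constant, and it vanishes at \<open>0\<close>, because \<open>- 1\<close> belongs to the circle and hence
  \<open>\<Phi> 0 = - \<Phi> 0\<close> (\<open>rk_map_hopf_norm\<close>). So \<open>\<Phi>\<close> maps the sphere of radius \<open>2\<close> to itself and the
  descended map \<open>\<phi>\<close> maps \<open>S2\<close> to itself. Its derivative is computed through a smooth local section of
  \<open>hopf\<close>. The area form on \<open>S2\<close> pulls back to \<open>\<omega>\<close> on the sphere of radius \<open>2\<close> (\<open>hopf_area\<close>), and \<open>\<Phi>\<close>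
  preserves \<open>\<omega>\<close>, so \<open>\<phi>\<close> preserves area (\<open>volume_preserving_S2_quotient\<close>).

  The integrator property holds with \<open>k = 1\<close>. For small \<open>h\<close> the stage equations are solved by
  contraction, uniformly on a ball, and \<open>\<Phi> z = z + h X z + O(h\<^sup>2)\<close> because the weights sum to \<open>1\<close>
  (\<open>rk_map_consistent\<close>). As \<open>hopf\<close> carries \<open>X\<close> to \<open>w \<mapsto> w \<times> \<nabla>H w\<close>, this gives
  \<open>\<phi> w = w + h (w \<times> \<nabla>H w) + O(h\<^sup>2)\<close> (\<open>hopf_consistent\<close>), and the flow of this field on \<open>S2\<close>, constructed
  in \<open>flow_on_sphere\<close>, has the same expansion.
\<close>

section \<open>Functions of class \<open>C\<^sup>k\<close>\<close>

lemma Ck_on_SucD: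
  assumes "Ck_on (Suc k) S f"
  shows "Ck_on k S f"
  using assms
proof (induction k arbitrary: f)
  case 0
  then obtain f' where "\<forall>x\<in>S. (f has_derivative f' x) (at x)"
    by auto
  then show ?case
    by (auto intro!: continuous_at_imp_continuous_on intro: has_derivative_continuous)
next
  case (Suc k)
  from Suc.prems obtain f' where f': "\<forall>x\<in>S. (f has_derivative f' x) (at x)"
    and "\<forall>v. Ck_on (Suc k) S (\<lambda>x. f' x v)"
    unfolding Ck_on.simps(2)[of "Suc k"] by blast
  then have "\<forall>v. Ck_on k S (\<lambda>x. f' x v)"
    using Suc.IH by blast
  with f' show ?case
    unfolding Ck_on.simps(2) by blast
qed

lemma Ck_on_const: "Ck_on k S (\<lambda>x. c)"
proof (induction k arbitrary: c)
  case (Suc k)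
  show ?case
    by (simp, rule exI[of _ "\<lambda>x v. 0"]) (auto simp: Suc)
qed simp

lemma Ck_on_bounded_linear:
  assumes "bounded_linear L"
  shows "Ck_on k S L"
proof (cases k)
  case 0
  then show ?thesis
    using assms by (simp add: linear_continuous_on)
next
  case (Suc n)
  then show ?thesis
    using assms by (auto intro!: exI[of _ "\<lambda>x. L"] bounded_linear_imp_has_derivative Ck_on_const)
qed

lemma Ck_on_bounded_linear_compose:
  assumes "bounded_linear L" "Ck_on k S f"
  shows "Ck_on k S (\<lambda>x. L (f x))"
  using assms(2)
proof (induction k arbitrary: f)
  case 0
  then show ?case
    using assms(1) by (simp add: bounded_linear.continuous_on)
next
  case (Suc k)
  then obtain f' where f': "\<forall>x\<in>S. (f has_derivative f' x) (at x)" "\<forall>v. Ck_on k S (\<lambda>x. f' x v)"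
    by auto
  then show ?case
    using Suc.IH
    by (auto intro!: exI[of _ "\<lambda>x v. L (f' x v)"] bounded_linear.has_derivative[OF assms(1)])
qed

lemma Ck_on_add:
  assumes "Ck_on k S f" "Ck_on k S g"
  shows "Ck_on k S (\<lambda>x. f x + g x)"
  using assms
proof (induction k arbitrary: f g)
  case (Suc k)
  then obtain f' g' where "\<forall>x\<in>S. (f has_derivative f' x) (at x)" "\<forall>v. Ck_on k S (\<lambda>x. f' x v)"
    "\<forall>x\<in>S. (g has_derivative g' x) (at x)" "\<forall>v. Ck_on k S (\<lambda>x. g' x v)"
    by auto
  then show ?case
    using Suc.IH by (auto intro!: exI[of _ "\<lambda>x v. f' x v + g' x v"] has_derivative_add)
qed (simp add: continuous_on_add)

lemma Ck_on_sum:
  assumes "\<And>i. i \<in> I \<Longrightarrow> Ck_on k S (f i)"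
  shows "Ck_on k S (\<lambda>x. \<Sum>i\<in>I. f i x)"
  using assms
proof (induction I rule: infinite_finite_induct)
  case (insert i I)
  then show ?case by (simp add: Ck_on_add)
qed (simp_all add: Ck_on_const)

text \<open>The product rule leaves a sum of two products of the same kind, one order lower, so induction
  over the order applies with \<open>f\<close> and \<open>g\<close> varying.\<close>

lemma Ck_on_bilinear:
  assumes p: "bounded_bilinear p" and "Ck_on k S f" "Ck_on k S g"
  shows "Ck_on k S (\<lambda>x. p (f x) (g x))"
  using assms(2,3)
proof (induction k arbitrary: f g)
  case 0
  then show ?case
    using bounded_bilinear.continuous_on[OF p] by simp
next
  case (Suc k)
  then obtain f' g' where *: "\<forall>x\<in>S. (f has_derivative f' x) (at x)" "\<forall>v. Ck_on k S (\<lambda>x. f' x v)"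
    "\<forall>x\<in>S. (g has_derivative g' x) (at x)" "\<forall>v. Ck_on k S (\<lambda>x. g' x v)"
    by auto
  have "Ck_on k S f" "Ck_on k S g"
    using Suc.prems Ck_on_SucD by blast+
  then have "Ck_on k S (\<lambda>x. p (f x) (g' x v) + p (f' x v) (g x))" for v
    using Suc.IH * by (auto intro: Ck_on_add)
  then show ?case
    using * by (auto intro!: exI[of _ "\<lambda>x v. p (f x) (g' x v) + p (f' x v) (g x)"]
        bounded_bilinear.FDERIV[OF p])
qed

lemma linear_sum_Basis:
  fixes L :: "'a::euclidean_space \<Rightarrow> 'b::real_vector"
  assumes "linear L"
  shows "L v = (\<Sum>b\<in>Basis. (v \<bullet> b) *\<^sub>R L b)"
proof -
  have "L v = L (\<Sum>b\<in>Basis. (v \<bullet> b) *\<^sub>R b)"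
    by (simp add: euclidean_representation)
  also have "\<dots> = (\<Sum>b\<in>Basis. (v \<bullet> b) *\<^sub>R L b)"
    by (simp add: linear_sum[OF assms] linear_cmul[OF assms])
  finally show ?thesis .
qed

text \<open>In a basis of the intermediate space the chain rule reads
  \<open>D (g \<circ> f) v = (\<Sum>b. (f' v \<bullet> b) *\<^sub>R (g' b \<circ> f))\<close>. Each \<open>g' b \<circ> f\<close> is a composition with a function of
  class one lower, hence covered by the induction hypothesis, and the bilinear case combines the
  factors.\<close>

lemma Ck_on_compose:
  fixes f :: "'a::real_normed_vector \<Rightarrow> 'b::euclidean_space"
    and g :: "'b \<Rightarrow> 'c::real_normed_vector"
  assumes "Ck_on k UNIV f" "Ck_on k UNIV g"
  shows "Ck_on k UNIV (g \<circ> f)"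
  using assms
proof (induction k arbitrary: g)
  case 0
  then show ?case
    using continuous_on_compose2[of UNIV g UNIV f] by (simp add: o_def)
next
  case (Suc k)
  then obtain f' g' where *: "\<forall>x. (f has_derivative f' x) (at x)" "\<forall>v. Ck_on k UNIV (\<lambda>x. f' x v)"
    "\<forall>x. (g has_derivative g' x) (at x)" "\<forall>v. Ck_on k UNIV (\<lambda>x. g' x v)"
    by auto
  have f: "Ck_on k UNIV f"
    using Suc.prems(1) by (rule Ck_on_SucD)
  have eq: "g' (f x) (f' x v) = (\<Sum>b\<in>Basis. (f' x v \<bullet> b) *\<^sub>R g' (f x) b)" for x v
    by (rule linear_sum_Basis[OF has_derivative_linear]) (use * in blast)
  have "Ck_on k UNIV (\<lambda>x. g' (f x) (f' x v))" for v
    unfolding eq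
  proof (intro Ck_on_sum Ck_on_bilinear[OF bounded_bilinear_scaleR])
    fix b :: 'b
    show "Ck_on k UNIV (\<lambda>x. f' x v \<bullet> b)"
      using * by (intro Ck_on_bounded_linear_compose[OF bounded_linear_inner_left]) auto
    show "Ck_on k UNIV (\<lambda>x. g' (f x) b)"
      using Suc.IH[OF f, of "\<lambda>y. g' y b"] * unfolding o_def by blast
  qed
  moreover have "(g \<circ> f has_derivative (\<lambda>v. g' (f x) (f' x v))) (at x)" for x
    using diff_chain_at[of f "f' x" x g "g' (f x)"] * unfolding o_def by blast
  ultimately show ?case
    unfolding Ck_on.simps(2) by (intro exI[of _ "\<lambda>x v. g' (f x) (f' x v)"]) blast
qed

lemma grad_inner:
  fixes f :: "'a::euclidean_space \<Rightarrow> real"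
  assumes "(f has_derivative f') (at x)"
  shows "grad f x \<bullet> v = f' v"
proof -
  have "f' v = (\<Sum>b\<in>Basis. (v \<bullet> b) *\<^sub>R f' b)"
    by (rule linear_sum_Basis[OF has_derivative_linear[OF assms]])
  moreover have "grad f x = (\<Sum>b\<in>Basis. f' b *\<^sub>R b)"
    unfolding grad_def frechet_derivative_at[OF assms, symmetric] ..
  ultimately show ?thesis
    by (simp add: inner_sum_left inner_commute[of v] mult.commute)
qed

lemma smooth_has_derivative_grad:
  assumes "smooth_on UNIV f"
  shows "(f has_derivative (\<lambda>v. grad f x \<bullet> v)) (at x)"
proof -
  have "Ck_on (Suc 0) UNIV f"
    using assms unfolding smooth_on_def by blast
  then obtain f' where f': "(f has_derivative f' x) (at x)"
    by auto
  then show ?thesis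
    unfolding grad_inner[OF f'] .
qed

lemma smooth_Ck_grad:
  assumes "smooth_on UNIV f"
  shows "Ck_on k UNIV (grad f)"
proof -
  have "Ck_on (Suc k) UNIV f"
    using assms unfolding smooth_on_def by blast
  then obtain f' where f': "\<forall>x. (f has_derivative f' x) (at x)" "\<forall>v. Ck_on k UNIV (\<lambda>x. f' x v)"
    by auto
  have "f' x = frechet_derivative f (at x)" for x
    by (rule frechet_derivative_at) (use f' in blast)
  then have eq: "grad f = (\<lambda>x. \<Sum>b\<in>Basis. f' x b *\<^sub>R b)"
    by (simp add: grad_def fun_eq_iff)
  show ?thesis
    unfolding eq
    by (intro Ck_on_sum Ck_on_bounded_linear_compose[OF bounded_linear_scaleR_left]) (use f' in blast)
qed

lemma smooth_on_compose:
  fixes f :: "'a::real_normed_vector \<Rightarrow> 'b::euclidean_space"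
  assumes "smooth_on UNIV f" "smooth_on UNIV g"
  shows "smooth_on UNIV (g \<circ> f)"
  using assms Ck_on_compose unfolding smooth_on_def by blast

lemma C1_derivative:
  assumes "Ck_on 1 UNIV X"
  shows "(X has_derivative frechet_derivative X (at x)) (at x)"
    and "continuous_on UNIV (\<lambda>x. frechet_derivative X (at x) v)"
proof -
  obtain X' where X': "\<forall>x. (X has_derivative X' x) (at x)" "\<forall>v. continuous_on UNIV (\<lambda>x. X' x v)"
    using assms by auto
  have "X' x = frechet_derivative X (at x)" for x
    by (rule frechet_derivative_at) (use X' in blast)
  then show "(X has_derivative frechet_derivative X (at x)) (at x)"
    and "continuous_on UNIV (\<lambda>x. frechet_derivative X (at x) v)"
    using X' by auto
qed

text \<open>Continuity of \<open>Ck_on\<close>-derivatives is known only direction by direction. Because of this bound,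
  finitely many directions control the operator norm.\<close>

lemma linear_bound_Basis:
  fixes L :: "'a::euclidean_space \<Rightarrow> 'b::real_normed_vector"
  assumes "linear L"
  shows "norm (L v) \<le> (\<Sum>b\<in>Basis. norm (L b)) * norm v"
proof -
  have "norm (L v) \<le> (\<Sum>b\<in>Basis. norm ((v \<bullet> b) *\<^sub>R L b))"
    unfolding linear_sum_Basis[OF assms, of v] by (rule norm_sum)
  also have "\<dots> \<le> (\<Sum>b\<in>Basis. norm v * norm (L b))"
    by (intro sum_mono) (simp add: Basis_le_norm mult_right_mono)
  finally show ?thesis
    by (simp add: sum_distrib_left mult.commute)
qed

lemma C1_bounds_cball:
  fixes X :: "'a::euclidean_space \<Rightarrow> 'b::real_normed_vector"
  assumes "Ck_on 1 UNIV X"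
  obtains M L where "M > 0" "L > 0"
    "\<forall>x\<in>cball 0 r. norm (X x) \<le> M"
    "\<forall>x\<in>cball 0 r. \<forall>v. norm (frechet_derivative X (at x) v) \<le> L * norm v"
    "\<forall>x\<in>cball 0 r. \<forall>y\<in>cball 0 r. norm (X x - X y) \<le> L * norm (x - y)"
proof -
  let ?D = "\<lambda>x. frechet_derivative X (at x)"
  note D = C1_derivative[OF assms]
  have "continuous_on (cball 0 r) X"
    using D(1) by (meson continuous_at_imp_continuous_on has_derivative_continuous)
  then have "bounded (X ` cball 0 r)"
    by (intro compact_imp_bounded compact_continuous_image) auto
  then obtain M where M: "M > 0" "\<And>x. x \<in> cball 0 r \<Longrightarrow> norm (X x) \<le> M"
    unfolding bounded_pos by auto
  have "continuous_on (cball 0 r) (\<lambda>x. \<Sum>b\<in>Basis. norm (?D x b))"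
    by (intro continuous_intros continuous_on_subset[OF D(2)]) auto
  then have "bounded ((\<lambda>x. \<Sum>b\<in>Basis. norm (?D x b)) ` cball 0 r)"
    by (intro compact_imp_bounded compact_continuous_image) auto
  then obtain L where L: "L > 0" "\<And>x. x \<in> cball 0 r \<Longrightarrow> (\<Sum>b\<in>Basis. norm (?D x b)) \<le> L"
    unfolding bounded_pos by (auto simp: sum_nonneg)
  have L': "norm (?D x v) \<le> L * norm v" if "x \<in> cball 0 r" for x v
    by (rule order_trans[OF linear_bound_Basis[OF has_derivative_linear[OF D(1)]]])
      (intro mult_right_mono L(2)[OF that] norm_ge_zero)
  have "norm (X x - X y) \<le> L * norm (x - y)" if "x \<in> cball 0 r" "y \<in> cball 0 r" for x y
  proof (rule differentiable_bound[of "cball 0 r" X ?D])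
    show "(X has_derivative ?D y) (at y within cball 0 r)" for y
      by (rule has_derivative_at_withinI[OF D(1)])
    show "onorm (?D y) \<le> L" if "y \<in> cball 0 r" for y
      by (rule onorm_le) (rule L'[OF that])
  qed (use that in auto)
  with M L(1) L' show ?thesis
    by (intro that[of M L]) auto
qed

section \<open>Uniqueness and equivariance of Runge--Kutta steps\<close>

text \<open>The usual hypothesis of continuity of the derivative in operator norm follows from continuity
  in the basis directions.\<close>

lemma C1_locally_injective:
  fixes f :: "'a::euclidean_space \<Rightarrow> 'b::euclidean_space"
  assumes f': "\<And>x. (f has_derivative f' x) (at x)"
    and cont: "\<And>v. continuous_on UNIV (\<lambda>x. f' x v)"
    and inj: "\<And>v. f' a v = 0 \<Longrightarrow> v = 0"
  obtains r where "r > 0" "inj_on f (ball a r)"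
proof -
  have lin: "linear (f' x)" for x
    by (rule has_derivative_linear[OF f'])
  then have "inj (f' a)"
    using inj linear_injective_0 by blast
  then obtain g where g: "linear g" "g \<circ> f' a = id"
    using linear_injective_left_inverse[OF lin] by blast
  have small: "\<exists>d>0. \<forall>x. dist a x < d \<longrightarrow> onorm (\<lambda>v. f' x v - f' a v) < e" if "e > 0" for e
  proof -
    let ?s = "\<lambda>x. \<Sum>b\<in>Basis. norm (f' x b - f' a b)"
    have "continuous_on UNIV ?s"
      by (intro continuous_intros cont)
    then have "isCont ?s a"
      by (simp add: continuous_on_eq_continuous_at)
    then obtain d where d: "d > 0" "\<And>x. dist x a < d \<Longrightarrow> dist (?s x) (?s a) < e"
      unfolding continuous_at_eps_delta using \<open>e > 0\<close> by blast
    have "onorm (\<lambda>v. f' x v - f' a v) < e" if "dist a x < d" for x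
    proof (rule le_less_trans)
      show "onorm (\<lambda>v. f' x v - f' a v) \<le> ?s x"
        by (intro onorm_le linear_bound_Basis linear_compose_sub lin)
      show "?s x < e"
        using d(2)[of x] that by (simp add: dist_commute dist_real_def)
    qed
    with d(1) show ?thesis
      by blast
  qed
  show ?thesis
    by (rule has_derivative_locally_injective[of a UNIV g f' f])
      (use g f' small that in \<open>auto simp: linear_conv_bounded_linear\<close>)
qed

lemma has_derivative_vec_lambda:
  fixes f :: "'a::real_normed_vector \<Rightarrow> 's::finite \<Rightarrow> 'b::euclidean_space"
  assumes "\<And>i. ((\<lambda>x. f x i) has_derivative (\<lambda>v. f' v i)) (at x)"
  shows "((\<lambda>x. \<chi> i. f x i) has_derivative (\<lambda>v. \<chi> i. f' v i)) (at x)"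
proof (subst has_derivative_componentwise_within, intro ballI)
  fix u :: "'b^'s"
  assume "u \<in> Basis"
  then obtain k w where "u = axis k w"
    unfolding Basis_vec_def by auto
  then show "((\<lambda>x. (\<chi> i. f x i) \<bullet> u) has_derivative (\<lambda>v. (\<chi> i. f' v i) \<bullet> u)) (at x)"
    using has_derivative_inner_left[OF assms[of k], of w] by (simp add: inner_axis)
qed

lemma rk_branchD:
  assumes "rk_branch A X z h Y"
  shows "continuous_on (closed_segment 0 h) (\<lambda>t. Y t i)"
    and "t \<in> closed_segment 0 h \<Longrightarrow> Y t i = z + t *\<^sub>R (\<Sum>j\<in>UNIV. A $ i $ j *\<^sub>R X (Y t j))"
    and "\<lbrakk>t \<in> closed_segment 0 h;
      \<And>i. V i = t *\<^sub>R (\<Sum>j\<in>UNIV. A $ i $ j *\<^sub>R frechet_derivative X (at (Y t j)) (V j))\<rbrakk>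
      \<Longrightarrow> V i = 0"
  using assms unfolding rk_branch_def by blast+

text \<open>For fixed \<open>z\<close>, the graph points \<open>(t, Y t)\<close> of all branches are mapped by
  \<open>G (t, V) = (t, V - t A X(V))\<close> to \<open>(t, (z, \<dots>, z))\<close>. The derivative of \<open>G\<close> at \<open>(t, Y t)\<close> is injective
  by nondegeneracy, so \<open>G\<close> is locally injective there, and two branches that agree at some \<open>t\<close> agree
  near \<open>t\<close>. They agree at \<open>0\<close>, and the segment of step sizes is connected.\<close>

lemma rk_branch_unique:
  fixes X :: "'v::euclidean_space \<Rightarrow> 'v" and A :: "real^'s^'s::finite"
  assumes X: "Ck_on 1 UNIV X"
    and Y: "rk_branch A X z h Y" and Z: "rk_branch A X z h Z"
    and t: "t \<in> closed_segment 0 h"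
  shows "Y t i = Z t i"
proof -
  let ?D = "\<lambda>x. frechet_derivative X (at x)" and ?S = "closed_segment 0 h"
  note D = C1_derivative[OF X]
  define G :: "real \<times> ('v^'s) \<Rightarrow> real \<times> ('v^'s)" where
    "G p = (fst p, \<chi> i. snd p $ i - fst p *\<^sub>R (\<Sum>j\<in>UNIV. A $ i $ j *\<^sub>R X (snd p $ j)))" for p
  define G' :: "real \<times> ('v^'s) \<Rightarrow> real \<times> ('v^'s) \<Rightarrow> real \<times> ('v^'s)" where
    "G' p q = (fst q, \<chi> i. snd q $ i -
       (fst p *\<^sub>R (\<Sum>j\<in>UNIV. A $ i $ j *\<^sub>R ?D (snd p $ j) (snd q $ j)) +
        fst q *\<^sub>R (\<Sum>j\<in>UNIV. A $ i $ j *\<^sub>R X (snd p $ j))))" for p q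
  have comp: "bounded_linear (\<lambda>p :: real \<times> ('v^'s). snd p $ j)" for j
    by (rule bounded_linear_compose[OF bounded_linear_vec_nth bounded_linear_snd])
  have Xj: "((\<lambda>p :: real \<times> ('v^'s). X (snd p $ j)) has_derivative
      (\<lambda>q. ?D (snd p $ j) (snd q $ j))) (at p)" for j p
    using diff_chain_at[OF bounded_linear_imp_has_derivative[OF comp] D(1)] by (simp add: o_def)
  have G': "(G has_derivative G' p) (at p)" for p
    unfolding G_def[abs_def] G'_def[abs_def]
    by (intro has_derivative_Pair has_derivative_vec_lambda has_derivative_diff has_derivative_scaleR
        has_derivative_sum has_derivative_scaleR_right Xj bounded_linear_imp_has_derivative comp
        bounded_linear_fst)
  have contX: "continuous_on UNIV X"
    using D(1) by (meson continuous_at_imp_continuous_on has_derivative_continuous)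
  have contXj: "continuous_on UNIV (\<lambda>p :: real \<times> ('v^'s). X (snd p $ j))" for j
    using continuous_on_compose2[OF contX linear_continuous_on[OF comp]] by simp
  have contDj: "continuous_on UNIV (\<lambda>p :: real \<times> ('v^'s). ?D (snd p $ j) v)" for j v
    using continuous_on_compose2[OF D(2) linear_continuous_on[OF comp]] by simp
  have contG': "continuous_on UNIV (\<lambda>p. G' p q)" for q
    unfolding G'_def by (intro continuous_intros contXj contDj)
  define path where "path W s = (s, \<chi> i. W s i)" for W :: "real \<Rightarrow> 's \<Rightarrow> 'v" and s :: real
  have cont: "continuous_on ?S (path Y)" "continuous_on ?S (path Z)"
    unfolding path_def[abs_def]
    by (intro continuous_on_Pair continuous_on_id continuous_on_vec_lambda
        rk_branchD(1)[OF Y] rk_branchD(1)[OF Z])+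
  have G_eq: "G (path Y s) = G (path Z s)" if "s \<in> ?S" for s
  proof -
    have "Y s i - s *\<^sub>R (\<Sum>j\<in>UNIV. A $ i $ j *\<^sub>R X (Y s j)) = z"
         "Z s i - s *\<^sub>R (\<Sum>j\<in>UNIV. A $ i $ j *\<^sub>R X (Z s j)) = z" for i
      using rk_branchD(2)[OF Y that, of i] rk_branchD(2)[OF Z that, of i] by (simp_all add: diff_eq_eq)
    then show ?thesis
      by (simp add: G_def path_def)
  qed
  let ?E = "{s \<in> ?S. path Y s - path Z s = 0}"
  have "openin (top_of_set ?S) ?E"
  proof (subst openin_euclidean_subtopology_iff, intro conjI ballI)
    fix s
    assume s: "s \<in> ?E"
    let ?a = "path Y s"
    \<comment> \<open>A null vector of the derivative has time component \<open>0\<close>, and its other component solves the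
        linearized stage equations.\<close>
    have inj: "q = 0" if "G' ?a q = 0" for q
    proof -
      have fst: "fst q = 0"
        using arg_cong[OF that, of fst] by (simp add: G'_def)
      have "snd q $ i = s *\<^sub>R (\<Sum>j\<in>UNIV. A $ i $ j *\<^sub>R ?D (Y s j) (snd q $ j))" for i
        using arg_cong[OF that, of "\<lambda>p. snd p $ i"] fst by (simp add: G'_def path_def)
      then have "snd q $ i = 0" for i
        using rk_branchD(3)[OF Y, of s "\<lambda>i. snd q $ i"] s by blast
      with fst show ?thesis
        by (simp add: prod_eq_iff vec_eq_iff)
    qed
    obtain r where r: "r > 0" "inj_on G (ball ?a r)"
      using C1_locally_injective[of G G' ?a] G' contG' inj by blast
    have "s \<in> ?S"
      using s by blast
    obtain d1 where d1: "d1 > 0" "\<forall>s'\<in>?S. dist s' s < d1 \<longrightarrow> dist (path Y s') ?a < r"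
      using cont(1) r(1) \<open>s \<in> ?S\<close> unfolding continuous_on_iff by blast
    obtain d2 where d2: "d2 > 0" "\<forall>s'\<in>?S. dist s' s < d2 \<longrightarrow> dist (path Z s') (path Z s) < r"
      using cont(2) r(1) \<open>s \<in> ?S\<close> unfolding continuous_on_iff by blast
    have "path Z s = ?a"
      using s by simp
    have "s' \<in> ?E" if "s' \<in> ?S" "dist s' s < min d1 d2" for s'
    proof -
      have "path Y s' \<in> ball ?a r" "path Z s' \<in> ball ?a r"
        using that d1 d2 \<open>path Z s = ?a\<close> by (auto simp: dist_commute)
      then show ?thesis
        using inj_onD[OF r(2) G_eq] that by simp
    qed
    then show "\<exists>e>0. \<forall>s'\<in>?S. dist s' s < e \<longrightarrow> s' \<in> ?E"
      using d1(1) d2(1) by (intro exI[of _ "min d1 d2"]) auto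
  qed auto
  moreover have "closedin (top_of_set ?S) ?E"
    by (intro continuous_closedin_preimage_constant continuous_intros cont)
  moreover have "0 \<in> ?E"
    using rk_branchD(2)[OF Y, of 0] rk_branchD(2)[OF Z, of 0] by (simp add: path_def prod_eq_iff vec_eq_iff)
  moreover have "connected ?S"
    by simp
  ultimately have "?E = ?S"
    unfolding connected_clopen by blast
  then have "path Y t = path Z t"
    using t by auto
  then show ?thesis
    by (simp add: path_def vec_eq_iff)
qed

lemma rk_map_eq:
  fixes X :: "'v::euclidean_space \<Rightarrow> 'v" and A :: "real^'s^'s::finite"
  assumes "Ck_on 1 UNIV X" "rk_branch A X z h Y"
  shows "rk_map A b X h z = z + h *\<^sub>R (\<Sum>i\<in>UNIV. b $ i *\<^sub>R X (Y h i))"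
proof -
  have "rk_branch A X z h (SOME Y. rk_branch A X z h Y)"
    using assms(2) someI[of "\<lambda>Y. rk_branch A X z h Y"] by blast
  then have "(SOME Y. rk_branch A X z h Y) h i = Y h i" for i
    by (rule rk_branch_unique[OF assms(1) _ assms(2)]) simp
  then show ?thesis
    by (simp add: rk_map_def)
qed

text \<open>Applying \<open>R\<close> to the stage equations of \<open>z\<close> gives those of \<open>R z\<close>. For the nondegeneracy, the
  derivatives at \<open>R x\<close> and at \<open>x\<close> are conjugate under \<open>R\<close>, so solutions of the linearized equations
  correspond to each other under \<open>S = R\<^sup>-\<^sup>1\<close>.\<close>

lemma rk_branch_equivariant:
  fixes X :: "'v::euclidean_space \<Rightarrow> 'v" and A :: "real^'s^'s::finite"
  assumes X: "Ck_on 1 UNIV X"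
    and R: "linear R" and S: "linear S" and RS: "\<And>x. R (S x) = x" and SR: "\<And>x. S (R x) = x"
    and eqv: "\<And>x. X (R x) = R (X x)"
    and Y: "rk_branch A X z h Y"
  shows "rk_branch A X (R z) h (\<lambda>t i. R (Y t i))"
proof -
  let ?D = "\<lambda>x. frechet_derivative X (at x)"
  note D = C1_derivative(1)[OF X]
  have "?D (R x) (R v) = R (?D x v)" for x v
  proof -
    have "((\<lambda>x. X (R x)) has_derivative (\<lambda>v. ?D (R x) (R v))) (at x)"
      using diff_chain_at[OF linear_imp_has_derivative[OF R] D] by (simp add: o_def)
    moreover have "((\<lambda>x. X (R x)) has_derivative (\<lambda>v. R (?D x v))) (at x)"
      unfolding eqv
      using R by (intro bounded_linear.has_derivative[OF _ D]) (simp add: linear_conv_bounded_linear)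
    ultimately show ?thesis
      using has_derivative_unique by metis
  qed
  then have DR: "?D (R x) v = R (?D x (S v))" for x v
    by (metis RS)
  show ?thesis
    unfolding rk_branch_def
  proof (intro conjI allI ballI impI)
    show "continuous_on (closed_segment 0 h) (\<lambda>t. R (Y t i))" for i
      by (rule bounded_linear.continuous_on[OF _ rk_branchD(1)[OF Y]])
        (use R in \<open>simp add: linear_conv_bounded_linear\<close>)
  next
    fix t i assume "t \<in> closed_segment 0 h"
    then have "R (Y t i) = R (z + t *\<^sub>R (\<Sum>j\<in>UNIV. A $ i $ j *\<^sub>R X (Y t j)))"
      by (rule arg_cong[OF rk_branchD(2)[OF Y]])
    then show "R (Y t i) = R z + t *\<^sub>R (\<Sum>j\<in>UNIV. A $ i $ j *\<^sub>R X (R (Y t j)))"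
      by (simp add: linear_add[OF R] linear_cmul[OF R] linear_sum[OF R] eqv)
  next
    fix t V i
    assume t: "t \<in> closed_segment 0 h"
      and V: "\<forall>i. V i = t *\<^sub>R (\<Sum>j\<in>UNIV. A $ i $ j *\<^sub>R ?D (R (Y t j)) (V j))"
    have "S (V i) = t *\<^sub>R (\<Sum>j\<in>UNIV. A $ i $ j *\<^sub>R ?D (Y t j) (S (V j)))" for i
    proof -
      have "S (V i) = S (t *\<^sub>R (\<Sum>j\<in>UNIV. A $ i $ j *\<^sub>R R (?D (Y t j) (S (V j)))))"
        using arg_cong[OF V[rule_format, of i], of S] unfolding DR .
      then show ?thesis
        by (simp add: linear_cmul[OF S] linear_sum[OF S] SR)
    qed
    then have "S (V i) = 0"
      using rk_branchD(3)[OF Y t, of "\<lambda>i. S (V i)"] by blast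
    then show "V i = 0"
      by (metis RS R linear_0)
  qed
qed

lemma rk_map_equivariant:
  fixes X :: "'v::euclidean_space \<Rightarrow> 'v" and A :: "real^'s^'s::finite"
  assumes X: "Ck_on 1 UNIV X"
    and R: "linear R" and S: "linear S" and RS: "\<And>x. R (S x) = x" and SR: "\<And>x. S (R x) = x"
    and eqv: "\<And>x. X (R x) = R (X x)"
    and z: "z \<in> rk_domain A X h"
  shows "rk_map A b X h (R z) = R (rk_map A b X h z)"
proof -
  obtain Y where Y: "rk_branch A X z h Y"
    using z unfolding rk_domain_def by blast
  show ?thesis
    unfolding rk_map_eq[OF X Y] rk_map_eq[OF X rk_branch_equivariant[OF X R S RS SR eqv Y]]
    by (simp add: linear_add[OF R] linear_cmul[OF R] linear_sum[OF R] eqv)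
qed

section \<open>Existence and consistency of Runge--Kutta steps\<close>

text \<open>The sum of all entries of \<open>A\<close> is a crude bound for the operator norm, good enough for a
  contraction with small step size.\<close>

lemma norm_stage_sum_le:
  fixes A :: "real^'s^'s::finite" and x :: "'s \<Rightarrow> 'v::real_normed_vector"
  assumes "\<And>j. norm (x j) \<le> c"
  shows "norm (\<chi> i. \<Sum>j\<in>UNIV. A $ i $ j *\<^sub>R x j) \<le> (\<Sum>i\<in>UNIV. \<Sum>j\<in>UNIV. \<bar>A $ i $ j\<bar>) * c"
proof -
  have "norm (\<chi> i. \<Sum>j\<in>UNIV. A $ i $ j *\<^sub>R x j) \<le> (\<Sum>i\<in>UNIV. norm (\<Sum>j\<in>UNIV. A $ i $ j *\<^sub>R x j))"
    unfolding norm_vec_def by (rule order_trans[OF L2_set_le_sum]) auto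
  also have "\<dots> \<le> (\<Sum>i\<in>UNIV. \<Sum>j\<in>UNIV. \<bar>A $ i $ j\<bar> * c)"
    using assms by (intro sum_mono order_trans[OF norm_sum]) (simp add: mult_left_mono)
  finally show ?thesis
    by (simp add: sum_distrib_right)
qed

text \<open>Composing with the nearest-point retraction, which is nonexpansive, turns Lipschitz bounds on a
  ball into global ones. Fixed-point arguments can then run on the whole space; solutions that stay in
  the ball do not notice the change.\<close>

lemma cball_truncation:
  fixes X :: "'a::euclidean_space \<Rightarrow> 'b::real_normed_vector"
  assumes "r \<ge> 0" and L: "L \<ge> 0"
    and M: "\<And>x. x \<in> cball 0 r \<Longrightarrow> norm (X x) \<le> M"
    and lip: "\<And>x y. \<lbrakk>x \<in> cball 0 r; y \<in> cball 0 r\<rbrakk> \<Longrightarrow> norm (X x - X y) \<le> L * norm (x - y)"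
  obtains g where "\<And>x. x \<in> cball 0 r \<Longrightarrow> g x = X x" "\<And>x. norm (g x) \<le> M"
    "\<And>x y. norm (g x - g y) \<le> L * norm (x - y)"
proof
  let ?p = "closest_point (cball (0::'a) r)"
  have B: "cball (0::'a) r \<noteq> {}"
    using assms(1) by simp
  have p: "?p x \<in> cball 0 r" for x
    by (rule closest_point_in_set[OF closed_cball B])
  show "X (?p x) = X x" if "x \<in> cball 0 r" for x
    using that by (simp add: closest_point_self)
  show "norm (X (?p x)) \<le> M" for x
    by (rule M[OF p])
  show "norm (X (?p x) - X (?p y)) \<le> L * norm (x - y)" for x y
  proof (rule order_trans[OF lip[OF p p]])
    have "norm (?p x - ?p y) \<le> norm (x - y)"
      using closest_point_lipschitz[OF convex_cball closed_cball B, of x y] by (simp add: dist_norm)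
    then show "L * norm (?p x - ?p y) \<le> L * norm (x - y)"
      by (rule mult_left_mono[OF _ L])
  qed
qed

text \<open>For \<open>\<bar>t\<bar> \<le> \<delta>\<close> the truncated stage equations are a fixed-point problem with contraction constant
  \<open>1 / 2\<close>. The fixed point depends on \<open>t\<close> in a Lipschitz way and stays within distance \<open>1\<close> of \<open>z\<close>, so
  it solves the original equations. The same contraction estimate for the linearized equations
  leaves only their zero solution.\<close>

lemma rk_branch_exists:
  fixes X :: "'v::euclidean_space \<Rightarrow> 'v" and A :: "real^'s^'s::finite"
  assumes X: "Ck_on 1 UNIV X" and r: "0 \<le> r"
  obtains \<delta> C where "\<delta> > 0" "C \<ge> 0"
    "\<forall>h z. \<bar>h\<bar> \<le> \<delta> \<longrightarrow> z \<in> cball 0 r \<longrightarrow>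
       (\<exists>Y. rk_branch A X z h Y \<and> (\<forall>i. Y h i \<in> cball 0 (r + 1) \<and> norm (Y h i - z) \<le> C * \<bar>h\<bar>))"
proof -
  let ?D = "\<lambda>x. frechet_derivative X (at x)"
  obtain M L where M: "M > 0" and L: "L > 0"
    and X_bd: "\<forall>x\<in>cball 0 (r + 1). norm (X x) \<le> M"
    and D_bd: "\<forall>x\<in>cball 0 (r + 1). \<forall>v. norm (?D x v) \<le> L * norm v"
    and X_lip: "\<forall>x\<in>cball 0 (r + 1). \<forall>y\<in>cball 0 (r + 1). norm (X x - X y) \<le> L * norm (x - y)"
    by (rule C1_bounds_cball[OF X, of "r + 1"])
  obtain g where g_eq: "\<And>x. x \<in> cball 0 (r + 1) \<Longrightarrow> g x = X x"
    and g_bd: "\<And>x. norm (g x) \<le> M" and g_lip: "\<And>x y. norm (g x - g y) \<le> L * norm (x - y)"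
    using cball_truncation[of "r + 1" L X M] r L X_bd X_lip by auto
  define N where "N = 1 + (\<Sum>i\<in>UNIV. \<Sum>j\<in>UNIV. \<bar>A $ i $ j\<bar>)"
  have N: "N \<ge> 1" "(\<Sum>i\<in>UNIV. \<Sum>j\<in>UNIV. \<bar>A $ i $ j\<bar>) \<le> N"
    unfolding N_def by (auto intro: sum_nonneg)
  define S :: "'v^'s \<Rightarrow> 'v^'s" where "S V = (\<chi> i. \<Sum>j\<in>UNIV. A $ i $ j *\<^sub>R g (V $ j))" for V
  have stage: "norm (\<chi> i. \<Sum>j\<in>UNIV. A $ i $ j *\<^sub>R x j) \<le> N * c"
    if "\<And>j. norm (x j) \<le> c" "c \<ge> 0" for x :: "'s \<Rightarrow> 'v" and c
    by (rule order_trans[OF norm_stage_sum_le mult_right_mono[OF N(2) that(2)]]) (rule that(1))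
  have S_bd: "norm (S V) \<le> N * M" for V
    unfolding S_def using g_bd M by (intro stage) auto
  have S_lip: "norm (S V - S W) \<le> N * (L * norm (V - W))" for V W
  proof -
    have "S V - S W = (\<chi> i. \<Sum>j\<in>UNIV. A $ i $ j *\<^sub>R (g (V $ j) - g (W $ j)))"
      by (simp add: S_def vec_eq_iff sum_subtractf scaleR_diff_right)
    moreover have "norm (g (V $ j) - g (W $ j)) \<le> L * norm (V - W)" for j
    proof -
      have "norm (V $ j - W $ j) \<le> norm (V - W)"
        using Finite_Cartesian_Product.norm_nth_le[of "V - W" j] by simp
      then show ?thesis
        using order_trans[OF g_lip mult_left_mono] L by (metis less_imp_le)
    qed
    ultimately show ?thesis
      using L by (simp add: stage)
  qed
  \<comment> \<open>With this \<open>\<delta>\<close>, \<open>\<delta> N L \<le> 1 / 2\<close> makes the stage map a contraction and \<open>\<delta> N M \<le> 1\<close> keeps the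
      stages in the ball of radius \<open>r + 1\<close>.\<close>
  define \<delta> where "\<delta> = 1 / (2 * N * (M + L))"
  have \<delta>: "\<delta> > 0"
    using N M L by (simp add: \<delta>_def)
  have "\<delta> * (N * L) + \<delta> * (N * M) = \<delta> * (N * (M + L))"
    by (simp add: algebra_simps)
  also have "\<dots> = 1 / 2"
    using N M L unfolding \<delta>_def by simp
  finally have "\<delta> * (N * L) + \<delta> * (N * M) = 1 / 2" .
  moreover have "\<delta> * (N * L) \<ge> 0" "\<delta> * (N * M) \<ge> 0"
    using \<delta> N M L by simp_all
  ultimately have \<delta>L: "\<delta> * (N * L) \<le> 1 / 2" and \<delta>M: "\<delta> * (N * M) \<le> 1"
    by linarith+
  have tL: "\<bar>t\<bar> * (N * (L * c)) \<le> 1 / 2 * c" if "\<bar>t\<bar> \<le> \<delta>" "c \<ge> 0" for t c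
  proof -
    have "\<bar>t\<bar> * (N * L) \<le> 1 / 2"
      by (rule order_trans[OF mult_right_mono[OF that(1)] \<delta>L]) (use N L in simp)
    from mult_right_mono[OF this that(2)] show ?thesis
      by (simp add: mult.assoc)
  qed
  have ex: "\<exists>V. V = (\<chi> i. z) + t *\<^sub>R S V" if "\<bar>t\<bar> \<le> \<delta>" for z t
  proof -
    have "\<exists>!V. (\<chi> i. z) + t *\<^sub>R S V = V"
    proof (rule banach_fix_type[of "1 / 2"])
      show "\<forall>V W. dist ((\<chi> i. z) + t *\<^sub>R S V) ((\<chi> i. z) + t *\<^sub>R S W) \<le> 1 / 2 * dist V W"
      proof (intro allI)
        fix V W :: "'v^'s"
        have "dist ((\<chi> i. z) + t *\<^sub>R S V) ((\<chi> i. z) + t *\<^sub>R S W) = \<bar>t\<bar> * norm (S V - S W)"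
          by (simp add: dist_norm flip: scaleR_diff_right)
        also have "\<dots> \<le> \<bar>t\<bar> * (N * (L * norm (V - W)))"
          by (intro mult_left_mono S_lip) simp
        also have "\<dots> \<le> 1 / 2 * norm (V - W)"
          using that by (rule tL) simp
        finally show "dist ((\<chi> i. z) + t *\<^sub>R S V) ((\<chi> i. z) + t *\<^sub>R S W) \<le> 1 / 2 * dist V W"
          by (simp add: dist_norm)
      qed
    qed auto
    then show ?thesis
      by metis
  qed
  define y where "y z t = (SOME V. V = (\<chi> i. z) + t *\<^sub>R S V)" for z t
  have y: "y z t = (\<chi> i. z) + t *\<^sub>R S (y z t)" if "\<bar>t\<bar> \<le> \<delta>" for z t
    unfolding y_def by (rule someI_ex[OF ex[OF that]])
  have near: "norm (y z t $ i - z) \<le> N * M * \<bar>t\<bar>" if "\<bar>t\<bar> \<le> \<delta>" for z t i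
  proof -
    have "y z t $ i - z = (t *\<^sub>R S (y z t)) $ i"
      using arg_cong[OF y[OF that, of z], of "\<lambda>V. V $ i"] by (simp add: algebra_simps)
    also have "norm \<dots> \<le> norm (t *\<^sub>R S (y z t))"
      by (rule Finite_Cartesian_Product.norm_nth_le)
    also have "\<dots> \<le> \<bar>t\<bar> * (N * M)"
      by (simp add: S_bd mult_left_mono)
    finally show ?thesis
      by (simp add: mult.commute)
  qed
  have inB: "y z t $ i \<in> cball 0 (r + 1)" if "\<bar>t\<bar> \<le> \<delta>" "z \<in> cball 0 r" for z t i
  proof -
    have "N * M * \<bar>t\<bar> \<le> 1"
      using order_trans[OF mult_right_mono[OF that(1), of "N * M"] \<delta>M] N M
      by (simp add: mult.commute)
    then have "norm (y z t $ i - z) \<le> 1"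
      using near[OF that(1), of z i] by linarith
    then show ?thesis
      using that(2) norm_triangle_sub[of "y z t $ i" z] by simp
  qed
  have y_lip: "norm (y z t - y z s) \<le> 2 * (N * M) * \<bar>t - s\<bar>" if "\<bar>t\<bar> \<le> \<delta>" "\<bar>s\<bar> \<le> \<delta>" for z t s
  proof -
    have "y z t - y z s = ((\<chi> i. z) + t *\<^sub>R S (y z t)) - ((\<chi> i. z) + s *\<^sub>R S (y z s))"
      by (rule arg_cong2[of _ _ _ _ minus, OF y[OF that(1)] y[OF that(2)]])
    also have "\<dots> = (t - s) *\<^sub>R S (y z t) + s *\<^sub>R (S (y z t) - S (y z s))"
      by (simp add: algebra_simps)
    finally have "norm (y z t - y z s) \<le> \<bar>t - s\<bar> * norm (S (y z t)) + \<bar>s\<bar> * norm (S (y z t) - S (y z s))"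
      by (metis norm_scaleR norm_triangle_ineq)
    also have "\<dots> \<le> \<bar>t - s\<bar> * (N * M) + \<bar>s\<bar> * (N * (L * norm (y z t - y z s)))"
      by (intro add_mono mult_left_mono S_bd S_lip) auto
    also have "\<dots> \<le> \<bar>t - s\<bar> * (N * M) + 1 / 2 * norm (y z t - y z s)"
      by (intro add_left_mono tL that(2)) simp
    finally show ?thesis
      by (simp add: algebra_simps)
  qed
  have branch: "rk_branch A X z h (\<lambda>t i. y z t $ i)" if h: "\<bar>h\<bar> \<le> \<delta>" and z: "z \<in> cball 0 r" for h z
    unfolding rk_branch_def
  proof (intro conjI allI ballI impI)
    have seg: "\<bar>t\<bar> \<le> \<delta>" if "t \<in> closed_segment 0 h" for t
      using that h by (auto simp: closed_segment_eq_real_ivl split: if_splits)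
    show "continuous_on (closed_segment 0 h) (\<lambda>t. y z t $ i)" for i
    proof (rule lipschitz_on_continuous_on, rule lipschitz_onI)
      fix t s assume "t \<in> closed_segment 0 h" "s \<in> closed_segment 0 h"
      then have "norm (y z t - y z s) \<le> 2 * (N * M) * \<bar>t - s\<bar>"
        by (intro y_lip seg)
      then show "dist (y z t $ i) (y z s $ i) \<le> 2 * (N * M) * dist t s"
        using Finite_Cartesian_Product.norm_nth_le[of "y z t - y z s" i] by (simp add: dist_norm)
    qed (use N M in simp)
    fix t assume "t \<in> closed_segment 0 h"
    then have t: "\<bar>t\<bar> \<le> \<delta>"
      by (rule seg)
    show "y z t $ i = z + t *\<^sub>R (\<Sum>j\<in>UNIV. A $ i $ j *\<^sub>R X (y z t $ j))" for i
      using arg_cong[OF y[OF t, of z], of "\<lambda>V. V $ i"] g_eq[OF inB[OF t z]] by (simp add: S_def)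
    fix V i
    assume V: "\<forall>i. V i = t *\<^sub>R (\<Sum>j\<in>UNIV. A $ i $ j *\<^sub>R ?D (y z t $ j) (V j))"
    let ?V = "\<chi> i. V i"
    have "norm (?D (y z t $ j) (V j)) \<le> L * norm ?V" for j
      using order_trans[OF D_bd[rule_format, OF inB[OF t z]] mult_left_mono] Finite_Cartesian_Product.norm_nth_le[of ?V j] L by simp
    then have W: "norm (\<chi> i. \<Sum>j\<in>UNIV. A $ i $ j *\<^sub>R ?D (y z t $ j) (V j)) \<le> N * (L * norm ?V)"
      using L by (intro stage) auto
    have "?V = t *\<^sub>R (\<chi> i. \<Sum>j\<in>UNIV. A $ i $ j *\<^sub>R ?D (y z t $ j) (V j))"
      unfolding vec_eq_iff vec_lambda_beta vector_scaleR_component by (rule V)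
    then have "norm ?V = norm (t *\<^sub>R (\<chi> i. \<Sum>j\<in>UNIV. A $ i $ j *\<^sub>R ?D (y z t $ j) (V j)))"
      by (rule arg_cong)
    also have "\<dots> \<le> \<bar>t\<bar> * (N * (L * norm ?V))"
      unfolding norm_scaleR by (rule mult_left_mono[OF W]) simp
    also have "\<dots> \<le> 1 / 2 * norm ?V"
      by (rule tL[OF t]) simp
    finally have "?V = 0"
      by simp
    then show "V i = 0"
      by (simp add: vec_eq_iff)
  qed
  show ?thesis
  proof (rule that[OF \<delta>])
    show "0 \<le> N * M"
      using N M by simp
    show "\<forall>h z. \<bar>h\<bar> \<le> \<delta> \<longrightarrow> z \<in> cball 0 r \<longrightarrow> (\<exists>Y. rk_branch A X z h Y \<and>
        (\<forall>i. Y h i \<in> cball 0 (r + 1) \<and> norm (Y h i - z) \<le> N * M * \<bar>h\<bar>))"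
      using branch inB near by blast
  qed
qed

text \<open>The stages differ from \<open>z\<close> by \<open>O(h)\<close>. As the weights sum to \<open>1\<close>, the increment differs from
  \<open>h X z\<close> by \<open>h\<close> times a weighted sum of the differences \<open>X (Y\<^sub>i) - X z\<close>, which are \<open>O(h)\<close>.\<close>

lemma rk_map_consistent:
  fixes X :: "'v::euclidean_space \<Rightarrow> 'v" and A :: "real^'s^'s::finite"
  assumes X: "Ck_on 1 UNIV X" and r: "0 \<le> r" and b: "(\<Sum>i\<in>UNIV. b $ i) = 1"
  obtains \<delta> C where "\<delta> > 0" "C \<ge> 0"
    "\<forall>h z. \<bar>h\<bar> \<le> \<delta> \<longrightarrow> z \<in> cball 0 r \<longrightarrow>
       z \<in> rk_domain A X h \<and> norm (rk_map A b X h z - (z + h *\<^sub>R X z)) \<le> C * h\<^sup>2"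
proof -
  obtain \<delta> C where \<delta>: "\<delta> > 0" "C \<ge> 0"
    and ex: "\<forall>h z. \<bar>h\<bar> \<le> \<delta> \<longrightarrow> z \<in> cball 0 r \<longrightarrow>
       (\<exists>Y. rk_branch A X z h Y \<and> (\<forall>i. Y h i \<in> cball 0 (r + 1) \<and> norm (Y h i - z) \<le> C * \<bar>h\<bar>))"
    by (rule rk_branch_exists[OF X r, where A = A])
  obtain M L where "M > 0" and L: "L > 0"
    and "\<forall>x\<in>cball 0 (r + 1). norm (X x) \<le> M"
    and "\<forall>x\<in>cball 0 (r + 1). \<forall>v. norm (frechet_derivative X (at x) v) \<le> L * norm v"
    and X_lip: "\<forall>x\<in>cball 0 (r + 1). \<forall>y\<in>cball 0 (r + 1). norm (X x - X y) \<le> L * norm (x - y)"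
    by (rule C1_bounds_cball[OF X, of "r + 1"])
  let ?K = "(\<Sum>i\<in>UNIV. \<bar>b $ i\<bar>) * (L * C)"
  show ?thesis
  proof (rule that[OF \<delta>(1)])
    show "0 \<le> ?K"
      using L \<delta> by (intro mult_nonneg_nonneg sum_nonneg) auto
    show "\<forall>h z. \<bar>h\<bar> \<le> \<delta> \<longrightarrow> z \<in> cball 0 r \<longrightarrow>
       z \<in> rk_domain A X h \<and> norm (rk_map A b X h z - (z + h *\<^sub>R X z)) \<le> ?K * h\<^sup>2"
    proof (intro allI impI conjI)
      fix h :: real and z :: 'v assume hz: "\<bar>h\<bar> \<le> \<delta>" "z \<in> cball 0 r"
      then obtain Y where Y: "rk_branch A X z h Y"
        and Yi: "\<And>i. Y h i \<in> cball 0 (r + 1)" "\<And>i. norm (Y h i - z) \<le> C * \<bar>h\<bar>"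
        using ex by blast
      show "z \<in> rk_domain A X h"
        using Y unfolding rk_domain_def by blast
      have "X z = (\<Sum>i\<in>UNIV. b $ i *\<^sub>R X z)"
        using b by (simp add: scaleR_sum_left[symmetric])
      then have "rk_map A b X h z - (z + h *\<^sub>R X z) = h *\<^sub>R (\<Sum>i\<in>UNIV. b $ i *\<^sub>R (X (Y h i) - X z))"
        unfolding rk_map_eq[OF X Y] by (simp add: scaleR_diff_right sum_subtractf)
      also have "norm \<dots> \<le> \<bar>h\<bar> * (\<Sum>i\<in>UNIV. \<bar>b $ i\<bar> * (L * (C * \<bar>h\<bar>)))"
      proof -
        have "norm (X (Y h i) - X z) \<le> L * (C * \<bar>h\<bar>)" for i
          using order_trans[OF X_lip[rule_format, OF Yi(1)] mult_left_mono[OF Yi(2)]] hz(2) L by simp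
        then have "norm (\<Sum>i\<in>UNIV. b $ i *\<^sub>R (X (Y h i) - X z)) \<le> (\<Sum>i\<in>UNIV. \<bar>b $ i\<bar> * (L * (C * \<bar>h\<bar>)))"
          by (intro order_trans[OF norm_sum] sum_mono) (simp add: mult_left_mono)
        then show ?thesis
          by (simp add: mult_left_mono)
      qed
      also have "\<dots> = ?K * \<bar>h\<bar>\<^sup>2"
        unfolding sum_distrib_right[symmetric] power2_eq_square by (simp only: mult_ac)
      finally show "norm (rk_map A b X h z - (z + h *\<^sub>R X z)) \<le> ?K * h\<^sup>2"
        by simp
    qed
  qed
qed

section \<open>Flows of tangent fields on the unit sphere\<close>

lemma vector_derivative_norm_bound:
  fixes u :: "real \<Rightarrow> 'a::real_normed_vector"
  assumes "convex S"
    and "\<And>t. t \<in> S \<Longrightarrow> (u has_vector_derivative u' t) (at t within S)"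
    and "\<And>t. t \<in> S \<Longrightarrow> norm (u' t) \<le> B"
    and "s \<in> S" "t \<in> S"
  shows "norm (u s - u t) \<le> B * \<bar>s - t\<bar>"
proof -
  have "norm (u s - u t) \<le> B * norm (s - t)"
  proof (rule differentiable_bound[of S u "\<lambda>t x. x *\<^sub>R u' t"])
    show "(u has_derivative (\<lambda>x. x *\<^sub>R u' r)) (at r within S)" if "r \<in> S" for r
      using assms(2)[OF that] by (simp add: has_vector_derivative_def)
    show "onorm (\<lambda>x. x *\<^sub>R u' r) \<le> B" if "r \<in> S" for r
      using assms(3)[OF that] by (intro onorm_le) (simp add: mult.commute[of B] mult_left_mono)
  qed (use assms in auto)
  then show ?thesis
    by simp
qed

text \<open>Banach's theorem for the integral equation on bounded continuous functions. Functions on the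
  whole line are used, with the time clamped to \<open>[-\<delta>, \<delta>]\<close>, in order to work in one complete space.
  The integral from \<open>0\<close> to \<open>t\<close> is written as a difference of integrals from \<open>-\<delta>\<close>, which avoids
  orientation for negative \<open>t\<close> and costs the factor \<open>3\<close> in the contraction condition.\<close>

lemma picard_lindelof_global:
  fixes g :: "'a::euclidean_space \<Rightarrow> 'a"
  assumes L: "L \<ge> 0" and lip: "\<And>x y. norm (g x - g y) \<le> L * norm (x - y)"
    and \<delta>: "\<delta> > 0" "3 * \<delta> * L \<le> 1 / 2"
  shows "\<exists>y. y 0 = w \<and> (\<forall>t\<in>{-\<delta>..\<delta>}. (y has_vector_derivative g (y t)) (at t within {-\<delta>..\<delta>}))"
proof -
  let ?I = "{-\<delta>..\<delta>}"
  define c where "c t = max (-\<delta>) (min \<delta> t)" for t :: real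
  have c: "c t \<in> ?I" "t \<in> ?I \<Longrightarrow> c t = t" for t
    using \<delta>(1) by (auto simp: c_def)
  have cont_g: "continuous_on UNIV g"
    by (rule lipschitz_on_continuous_on[of L], rule lipschitz_onI) (use L lip in \<open>auto simp: dist_norm\<close>)
  define J where "J y t = w + (integral {-\<delta>..c t} (\<lambda>s. g (y s)) - integral {-\<delta>..0} (\<lambda>s. g (y s)))"
    for y :: "real \<Rightarrow> 'a" and t
  have gy: "continuous_on S (\<lambda>s. g (apply_bcontfun y s))" for S and y :: "real \<Rightarrow>\<^sub>C 'a"
    by (rule continuous_on_compose2[OF cont_g]) auto
  have J_bcontfun: "J (apply_bcontfun y) \<in> bcontfun" for y :: "real \<Rightarrow>\<^sub>C 'a"
  proof -
    let ?K = "\<lambda>t. w + (integral {-\<delta>..t} (\<lambda>s. g (y s)) - integral {-\<delta>..0} (\<lambda>s. g (y s)))"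
    have K: "continuous_on ?I ?K"
      by (intro continuous_intros indefinite_integral_continuous_1 integrable_continuous_real gy)
    have "continuous_on UNIV c"
      unfolding c_def by (intro continuous_intros)
    then have "continuous_on UNIV (\<lambda>t. ?K (c t))"
      by (rule continuous_on_compose2[OF K]) (use c in auto)
    moreover have "bounded (?K ` ?I)"
      by (intro compact_imp_bounded compact_continuous_image K) simp
    then have "bounded (range (\<lambda>t. ?K (c t)))"
      by (rule bounded_subset) (use c(1) in auto)
    ultimately show ?thesis
      by (simp add: bcontfun_def J_def[abs_def])
  qed
  define T where "T y = Bcontfun (J (apply_bcontfun y))" for y :: "real \<Rightarrow>\<^sub>C 'a"
  have T: "apply_bcontfun (T y) = J (apply_bcontfun y)" for y
    unfolding T_def by (rule Bcontfun_inverse[OF J_bcontfun])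
  have "dist (T y) (T x) \<le> 1 / 2 * dist y x" for x y
  proof (rule dist_bound)
    fix t
    let ?d = "\<lambda>s. g (y s) - g (x s)" and ?B = "L * dist y x"
    have d: "norm (?d s) \<le> ?B" for s
      by (rule order_trans[OF lip mult_left_mono[OF _ L]])
        (use dist_bounded[of y s x] in \<open>simp add: dist_norm\<close>)
    have int: "norm (integral {-\<delta>..b} ?d) \<le> ?B * (2 * \<delta>)" if "b \<in> ?I" for b
    proof -
      have "norm (integral {-\<delta>..b} ?d) \<le> ?B * (b - (-\<delta>))"
        using that by (intro integral_bound continuous_intros gy d) auto
      also have "\<dots> \<le> ?B * (2 * \<delta>)"
        using that L by (intro mult_left_mono) auto
      finally show ?thesis .
    qed
    have int0: "norm (integral {-\<delta>..0} ?d) \<le> ?B * \<delta>"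
      using integral_bound[of "-\<delta>" 0 ?d ?B] \<delta>(1) d by (simp add: continuous_on_diff gy)
    have diff: "integral {-\<delta>..b} (\<lambda>s. g (y s)) - integral {-\<delta>..b} (\<lambda>s. g (x s)) = integral {-\<delta>..b} ?d" for b
      by (rule integral_diff[symmetric]) (intro integrable_continuous_real gy)+
    have eq: "T y t - T x t = integral {-\<delta>..c t} ?d - integral {-\<delta>..0} ?d"
      unfolding T J_def diff[symmetric] by simp
    have "norm (integral {-\<delta>..c t} ?d - integral {-\<delta>..0} ?d) \<le> ?B * (2 * \<delta>) + ?B * \<delta>"
      by (rule order_trans[OF norm_triangle_ineq4 add_mono[OF int[OF c(1)] int0]])
    then have "dist (T y t) (T x t) \<le> ?B * (2 * \<delta>) + ?B * \<delta>"
      unfolding eq[symmetric] dist_norm[symmetric] .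
    also have "\<dots> = 3 * \<delta> * L * dist y x"
      by (simp add: algebra_simps)
    also have "\<dots> \<le> 1 / 2 * dist y x"
      by (rule mult_right_mono[OF \<delta>(2)]) simp
    finally show "dist (T y t) (T x t) \<le> 1 / 2 * dist y x" .
  qed
  then have "\<exists>!y. T y = y"
    by (intro banach_fix_type[of "1 / 2"]) auto
  then obtain y where y: "T y = y"
    by blast
  have y_eq: "y t = J y t" for t
    using arg_cong[OF y, of "\<lambda>y. apply_bcontfun y t"] unfolding T by simp
  have "y 0 = w"
    using y_eq[of 0] c(2)[of 0] \<delta>(1) by (simp add: J_def)
  moreover have "(apply_bcontfun y has_vector_derivative g (y t)) (at t within ?I)" if t: "t \<in> ?I" for t
  proof -
    have "((\<lambda>t. w + (integral {-\<delta>..t} (\<lambda>s. g (y s)) - integral {-\<delta>..0} (\<lambda>s. g (y s))))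
        has_vector_derivative 0 + (g (y t) - 0)) (at t within ?I)"
      by (intro has_vector_derivative_add has_vector_derivative_diff has_vector_derivative_const
          integral_has_vector_derivative gy t)
    then have der: "((\<lambda>t. w + (integral {-\<delta>..t} (\<lambda>s. g (y s)) - integral {-\<delta>..0} (\<lambda>s. g (y s))))
        has_vector_derivative g (y t)) (at t within ?I)"
      by simp
    show ?thesis
    proof (rule has_vector_derivative_transform[OF t _ der])
      fix s assume "s \<in> ?I"
      then have "c s = s"
        by (rule c(2))
      then show "y s = w + (integral {-\<delta>..s} (\<lambda>s. g (y s)) - integral {-\<delta>..0} (\<lambda>s. g (y s)))"
        unfolding y_eq[of s] J_def by simp
    qed
  qed
  ultimately show ?thesis
    by blast
qed

text \<open>The square of the norm is constant along solutions because its derivative is \<open>2 (x \<bullet> f x)\<close>. The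
  derivative of \<open>\<psi> t w - t f w\<close> is \<open>f (\<psi> t w) - f w\<close>, which is \<open>O(t)\<close>; this gives the expansion. The
  interval can be shrunk, so that it can be matched with the step sizes of the method.\<close>

lemma flow_on_sphere:
  fixes f :: "'a::euclidean_space \<Rightarrow> 'a"
  assumes f: "Ck_on 1 UNIV f" and tangent: "\<And>x. x \<bullet> f x = 0"
  obtains \<epsilon> \<psi> C where "\<epsilon> > 0" "C \<ge> 0"
    "\<forall>\<delta>. 0 < \<delta> \<and> \<delta> \<le> \<epsilon> \<longrightarrow> flow_on \<delta> (sphere 0 1) f \<psi>"
    "\<forall>h\<in>{-\<epsilon>..\<epsilon>}. \<forall>w\<in>sphere 0 1. norm (\<psi> h w - (w + h *\<^sub>R f w)) \<le> C * h\<^sup>2"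
proof -
  obtain M L where M: "M > 0" and L: "L > 0"
    and f_bd: "\<forall>x\<in>cball 0 2. norm (f x) \<le> M"
    and "\<forall>x\<in>cball 0 2. \<forall>v. norm (frechet_derivative f (at x) v) \<le> L * norm v"
    and f_lip: "\<forall>x\<in>cball 0 2. \<forall>y\<in>cball 0 2. norm (f x - f y) \<le> L * norm (x - y)"
    by (rule C1_bounds_cball[OF f, of 2])
  obtain g where g_eq: "\<And>x. x \<in> cball 0 2 \<Longrightarrow> g x = f x"
    and g_bd: "\<And>x. norm (g x) \<le> M" and g_lip: "\<And>x y. norm (g x - g y) \<le> L * norm (x - y)"
    using cball_truncation[of 2 L f M] L f_bd f_lip by auto
  \<comment> \<open>Small enough for existence (\<open>3 \<epsilon> L \<le> 1 / 2\<close>) and for staying within distance \<open>1\<close> of the initial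
      point (\<open>\<epsilon> M \<le> 1\<close>), hence in the ball of radius \<open>2\<close> where \<open>g\<close> equals \<open>f\<close>.\<close>
  define \<epsilon> where "\<epsilon> = 1 / (6 * (M + L))"
  have "\<epsilon> > 0"
    using M L by (simp add: \<epsilon>_def)
  have "6 * (\<epsilon> * M) + 6 * (\<epsilon> * L) = \<epsilon> * (6 * (M + L))"
    by (simp add: algebra_simps)
  also have "\<dots> = 1"
    using M L by (simp add: \<epsilon>_def)
  finally have "6 * (\<epsilon> * M) + 6 * (\<epsilon> * L) = 1" .
  moreover have "\<epsilon> * M \<ge> 0" "\<epsilon> * L \<ge> 0"
    using \<open>\<epsilon> > 0\<close> M L by simp_all
  ultimately have \<epsilon>: "\<epsilon> * M \<le> 1" "3 * \<epsilon> * L \<le> 1 / 2"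
    by linarith+
  let ?I = "{-\<epsilon>..\<epsilon>}"
  define P where "P w y \<longleftrightarrow> y 0 = w \<and>
    (\<forall>t\<in>?I. (y has_vector_derivative g (y t)) (at t within ?I))" for w y
  define \<psi>' where "\<psi>' w = (SOME y. P w y)" for w
  have "\<exists>y. P w y" for w
    unfolding P_def by (rule picard_lindelof_global[OF _ g_lip \<open>\<epsilon> > 0\<close> \<epsilon>(2)]) (use L in simp)
  then have "P w (\<psi>' w)" for w
    unfolding \<psi>'_def by (rule someI_ex)
  then have \<psi>0: "\<psi>' w 0 = w"
    and \<psi>g: "\<And>t. t \<in> ?I \<Longrightarrow> (\<psi>' w has_vector_derivative g (\<psi>' w t)) (at t within ?I)" for w
    unfolding P_def by blast+
  have near: "norm (\<psi>' w t - w) \<le> M * \<bar>t\<bar>" if "t \<in> ?I" for w t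
    using vector_derivative_norm_bound[OF _ \<psi>g[of _ w] g_bd that, of 0] \<psi>0[of w] \<open>\<epsilon> > 0\<close> by simp
  have inB: "\<psi>' w t \<in> cball 0 2" if "t \<in> ?I" "w \<in> sphere 0 1" for w t
  proof -
    have "\<bar>t\<bar> \<le> \<epsilon>"
      using that(1) by auto
    then have "M * \<bar>t\<bar> \<le> 1"
      using order_trans[OF mult_left_mono[of "\<bar>t\<bar>" \<epsilon> M]] M \<epsilon>(1) by (simp add: mult.commute)
    then have "norm (\<psi>' w t - w) \<le> 1"
      using near[OF that(1), of w] by linarith
    then show ?thesis
      using that(2) norm_triangle_sub[of "\<psi>' w t" w] by simp
  qed
  have \<psi>f: "(\<psi>' w has_vector_derivative f (\<psi>' w t)) (at t within ?I)"
    if "t \<in> ?I" "w \<in> sphere 0 1" for w t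
    using \<psi>g[OF that(1), of w] unfolding g_eq[OF inB[OF that]] .
  have sphere: "\<psi>' w t \<in> sphere 0 1" if t: "t \<in> ?I" and w: "w \<in> sphere 0 1" for w t
  proof -
    have const: "((\<lambda>t. \<psi>' w t \<bullet> \<psi>' w t) has_derivative (\<lambda>h. 0)) (at s within ?I)" if "s \<in> ?I" for s
    proof -
      have "((\<lambda>t. \<psi>' w t \<bullet> \<psi>' w t) has_derivative
          (\<lambda>h. \<psi>' w s \<bullet> (h *\<^sub>R f (\<psi>' w s)) + (h *\<^sub>R f (\<psi>' w s)) \<bullet> \<psi>' w s)) (at s within ?I)"
        using \<psi>f[OF that w] unfolding has_vector_derivative_def
        by (intro has_derivative_inner)
      then show ?thesis
        using tangent[of "\<psi>' w s"]
        by (simp add: inner_commute[of "f _"])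
    qed
    have "\<psi>' w t \<bullet> \<psi>' w t = \<psi>' w 0 \<bullet> \<psi>' w 0"
      by (rule has_derivative_zero_unique[OF convex_real_interval(5) const t]) (use \<open>\<epsilon> > 0\<close> in auto)
    then show ?thesis
      using w \<psi>0[of w] by (simp add: norm_eq_sqrt_inner)
  qed
  have local_error: "norm (\<psi>' w t - (w + t *\<^sub>R f w)) \<le> L * M * t\<^sup>2"
    if t: "t \<in> ?I" and w: "w \<in> sphere 0 1" for w t
  proof -
    let ?S = "closed_segment 0 t"
    have S: "?S \<subseteq> ?I"
      using t \<open>\<epsilon> > 0\<close> by (auto simp: closed_segment_eq_real_ivl split: if_splits)
    have "norm ((\<psi>' w t - t *\<^sub>R f w) - (\<psi>' w 0 - 0 *\<^sub>R f w)) \<le> (L * (M * \<bar>t\<bar>)) * \<bar>t - 0\<bar>"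
    proof (rule vector_derivative_norm_bound[of ?S "\<lambda>s. \<psi>' w s - s *\<^sub>R f w" "\<lambda>s. f (\<psi>' w s) - f w"])
      fix s assume s: "s \<in> ?S"
      have "((\<lambda>s. s *\<^sub>R f w) has_vector_derivative f w) (at s within ?S)"
        unfolding has_vector_derivative_def
        by (rule bounded_linear_imp_has_derivative[OF bounded_linear_scaleR_left])
      moreover have "(\<psi>' w has_vector_derivative f (\<psi>' w s)) (at s within ?S)"
        using has_vector_derivative_within_subset[OF \<psi>f[OF _ w] S] s S by blast
      ultimately show "((\<lambda>s. \<psi>' w s - s *\<^sub>R f w) has_vector_derivative f (\<psi>' w s) - f w) (at s within ?S)"
        by (intro has_vector_derivative_diff)
      have "\<bar>s\<bar> \<le> \<bar>t\<bar>"
        using s by (auto simp: closed_segment_eq_real_ivl split: if_splits)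
      then have "norm (\<psi>' w s - w) \<le> M * \<bar>t\<bar>"
        using near[of s w] s S M by (meson less_imp_le mult_left_mono order_trans subsetD)
      then show "norm (f (\<psi>' w s) - f w) \<le> L * (M * \<bar>t\<bar>)"
        using order_trans[OF f_lip[rule_format, of "\<psi>' w s" w] mult_left_mono] inB[of s w] s S w L
        by auto
    qed auto
    then show ?thesis
      using \<psi>0[of w] by (simp add: algebra_simps power2_eq_square flip: abs_mult)
  qed
  show ?thesis
  proof (rule that[OF \<open>\<epsilon> > 0\<close>])
    show "L * M \<ge> 0"
      using L M by simp
    show "\<forall>\<delta>. 0 < \<delta> \<and> \<delta> \<le> \<epsilon> \<longrightarrow> flow_on \<delta> (sphere 0 1) f (\<lambda>t w. \<psi>' w t)"
    proof (intro allI impI)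
      fix \<delta> assume "0 < \<delta> \<and> \<delta> \<le> \<epsilon>"
      then have sub: "{-\<delta>..\<delta>} \<subseteq> ?I"
        by auto
      show "flow_on \<delta> (sphere 0 1) f (\<lambda>t w. \<psi>' w t)"
        unfolding flow_on_def
      proof (intro ballI conjI)
        fix w :: 'a and t assume w: "w \<in> sphere 0 1" and "t \<in> {-\<delta>..\<delta>}"
        with sub have t: "t \<in> ?I"
          by blast
        show "\<psi>' w t \<in> sphere 0 1"
          by (rule sphere[OF t w])
        show "(\<psi>' w has_vector_derivative f (\<psi>' w t)) (at t within {-\<delta>..\<delta>})"
          by (rule has_vector_derivative_within_subset[OF \<psi>f[OF t w] sub])
      qed (rule \<psi>0)
    qed
    show "\<forall>h\<in>?I. \<forall>w\<in>sphere 0 1. norm (\<psi>' w h - (w + h *\<^sub>R f w)) \<le> L * M * h\<^sup>2"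
      using local_error by blast
  qed
qed

section \<open>The Hopf map and the circle action\<close>

text \<open>Multiplication by \<open>i\<close> in the coordinates \<open>z\<^sub>k = q\<^sub>k + i p\<^sub>k\<close>. The form
  \<open>quarter_turn u \<bullet> v\<close> is \<open>\<Sum>\<^sub>k dq\<^sub>k \<and> dp\<^sub>k\<close>.\<close>

definition quarter_turn :: "cotangent_plane \<Rightarrow> cotangent_plane" where
  "quarter_turn z = (- snd z, fst z)"

definition circle_action :: "real \<Rightarrow> cotangent_plane \<Rightarrow> cotangent_plane" where
  "circle_action \<theta> z = cos \<theta> *\<^sub>R z + sin \<theta> *\<^sub>R quarter_turn z"

text \<open>Twice the polarization of the quadratic map \<open>hopf\<close>, that is, its derivative at \<open>z\<close> applied to
  \<open>v\<close>.\<close>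

definition hopf_deriv :: "cotangent_plane \<Rightarrow> cotangent_plane \<Rightarrow> real^3" where
  "hopf_deriv = (\<lambda>(q, p) (a, c). (1/2) *\<^sub>R vector
     [a$1 * q$2 + q$1 * a$2 + c$1 * p$2 + p$1 * c$2,
      a$1 * p$2 + q$1 * c$2 - a$2 * p$1 - q$2 * c$1,
      q$1 * a$1 + p$1 * c$1 - q$2 * a$2 - p$2 * c$2])"

text \<open>The adjoint of \<open>hopf_deriv z\<close>. It equals \<open>1/2\<close> times the action of \<open>g\<close> on \<open>z\<close> as a linear
  combination of Pauli matrices.\<close>

definition hopf_adjoint :: "cotangent_plane \<Rightarrow> real^3 \<Rightarrow> cotangent_plane" where
  "hopf_adjoint = (\<lambda>(q, p) g. ((1/2) *\<^sub>R vector
     [g$1 * q$2 + g$2 * p$2 + g$3 * q$1, g$1 * q$1 - g$2 * p$1 - g$3 * q$2],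
     (1/2) *\<^sub>R vector
     [g$1 * p$2 - g$2 * q$2 + g$3 * p$1, g$1 * p$1 + g$2 * q$1 - g$3 * p$2]))"

lemmas coordinates = vec_eq_iff forall_2 forall_3 prod_eq_iff inner_prod_def inner_vec_def sum_2 sum_3
  split_def hopf_def hopf_deriv_def hopf_adjoint_def quarter_turn_def cross3_def

lemma linear_quarter_turn: "linear quarter_turn"
  by (rule linearI) (auto simp: quarter_turn_def)

lemma quarter_turn_quarter_turn: "quarter_turn (quarter_turn z) = - z"
  by (simp add: quarter_turn_def prod_eq_iff)

lemma inner_quarter_turn: "quarter_turn u \<bullet> quarter_turn v = u \<bullet> v"
  by (simp add: quarter_turn_def inner_prod_def)

lemma inner_quarter_turn_skew: "quarter_turn u \<bullet> v = - (u \<bullet> quarter_turn v)"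
  by (simp add: quarter_turn_def inner_prod_def inner_commute)

lemma hopf_add: "hopf (z + v) = hopf z + hopf_deriv z v + hopf v"
  by (simp add: coordinates power2_eq_square algebra_simps)

lemma hopf_scaleR: "hopf (c *\<^sub>R z) = c\<^sup>2 *\<^sub>R hopf z"
  by (simp add: coordinates power2_eq_square algebra_simps)

lemma hopf_eq_hopf_deriv: "hopf z = (1/2) *\<^sub>R hopf_deriv z z"
  by (simp add: coordinates power2_eq_square algebra_simps)

lemma hopf_deriv_commute: "hopf_deriv z v = hopf_deriv v z"
  by (simp add: coordinates algebra_simps)

lemma bounded_bilinear_hopf_deriv: "bounded_bilinear hopf_deriv"
proof -
  have "linear (hopf_deriv z)" for z
    by (rule linearI) (simp_all add: coordinates algebra_simps)
  then have "bilinear hopf_deriv"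
    unfolding bilinear_def using hopf_deriv_commute by (simp add: hopf_deriv_commute)
  then show ?thesis
    by (simp add: bilinear_conv_bounded_bilinear)
qed

lemma hopf_has_derivative: "(hopf has_derivative hopf_deriv z) (at z)"
proof -
  have "((\<lambda>z. (1/2) *\<^sub>R hopf_deriv z z) has_derivative
      (\<lambda>v. (1/2) *\<^sub>R (hopf_deriv z v + hopf_deriv v z))) (at z)"
    by (intro has_derivative_scaleR_right bounded_bilinear.FDERIV[OF bounded_bilinear_hopf_deriv]
        has_derivative_ident)
  moreover have "(\<lambda>v. (1/2) *\<^sub>R (hopf_deriv z v + hopf_deriv v z)) = hopf_deriv z"
    by (simp add: hopf_deriv_commute[of _ z] flip: scaleR_2)
  ultimately show ?thesis
    by (simp add: hopf_eq_hopf_deriv[abs_def, symmetric])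
qed

lemma smooth_on_hopf: "smooth_on UNIV hopf"
  unfolding smooth_on_def hopf_eq_hopf_deriv[abs_def]
  by (intro allI Ck_on_bounded_linear_compose[OF bounded_linear_scaleR_right]
      Ck_on_bilinear[OF bounded_bilinear_hopf_deriv] Ck_on_bounded_linear bounded_linear_ident)

text \<open>The identity \<open>(2 \<bar>z\<^sub>1\<bar> \<bar>z\<^sub>2\<bar>)\<^sup>2 + (\<bar>z\<^sub>1\<bar>\<^sup>2 - \<bar>z\<^sub>2\<bar>\<^sup>2)\<^sup>2 = (\<bar>z\<^sub>1\<bar>\<^sup>2 + \<bar>z\<^sub>2\<bar>\<^sup>2)\<^sup>2\<close>.\<close>

lemma norm_hopf: "norm (hopf z) = (norm z)\<^sup>2 / 4"
proof -
  have "hopf z \<bullet> hopf z = ((z \<bullet> z) / 4)\<^sup>2"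
    by (simp add: coordinates power2_eq_square field_simps)
  then show ?thesis
    by (simp add: norm_eq_sqrt_inner)
qed

lemma hopf_circle_action: "hopf (circle_action \<theta> z) = hopf z"
proof -
  have "hopf (quarter_turn z) = hopf z" "hopf_deriv z (quarter_turn z) = 0"
    by (simp_all add: coordinates algebra_simps)
  moreover have "hopf_deriv (cos \<theta> *\<^sub>R z) (sin \<theta> *\<^sub>R quarter_turn z) =
      (cos \<theta> * sin \<theta>) *\<^sub>R hopf_deriv z (quarter_turn z)"
    by (simp add: bounded_bilinear.scaleR_left[OF bounded_bilinear_hopf_deriv]
        bounded_bilinear.scaleR_right[OF bounded_bilinear_hopf_deriv])
  ultimately show ?thesis
    by (simp add: circle_action_def hopf_add hopf_scaleR flip: scaleR_left_distrib)
qed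

lemma inner_hopf_adjoint: "hopf_adjoint z g \<bullet> v = g \<bullet> hopf_deriv z v"
  by (simp add: coordinates field_simps)

lemma linear_hopf_adjoint: "linear (hopf_adjoint z)"
  by (rule linearI) (simp_all add: coordinates algebra_simps)

lemma hopf_deriv_adjoint: "hopf_deriv z (hopf_adjoint z g) = ((z \<bullet> z) / 4) *\<^sub>R g"
  by (simp add: coordinates algebra_simps)

text \<open>This is the statement that \<open>hopf\<close> is a Poisson map.\<close>

lemma hopf_deriv_quarter_turn_adjoint:
  "hopf_deriv z (quarter_turn (hopf_adjoint z g)) = cross3 (hopf z) g"
  by (simp add: coordinates power2_eq_square algebra_simps)

text \<open>The Pauli matrix of \<open>g\<close>, acting on spinors, induces the half turn about the axis \<open>g\<close> on their
  images under \<open>hopf\<close>, up to scale.\<close>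

lemma hopf_adjoint_reflection:
  "4 *\<^sub>R hopf (hopf_adjoint z g) = (2 * (g \<bullet> hopf z)) *\<^sub>R g - (g \<bullet> g) *\<^sub>R hopf z"
  by (simp add: coordinates power2_eq_square field_simps)

lemma inner_hopf_deriv: "hopf z \<bullet> hopf_deriv z v = (z \<bullet> z) / 8 * (z \<bullet> v)"
  by (simp add: coordinates power2_eq_square field_simps)

text \<open>For vectors tangent to the sphere of radius \<open>2\<close> the area form of \<open>S2\<close> pulls back to the
  symplectic form. Without the tangency conditions there is an identity with two correction terms,
  which is a polynomial identity in the coordinates; the factors \<open>4\<close> and \<open>2\<close> clear denominators.\<close>

lemma hopf_area:
  assumes "z \<bullet> z = 4" "z \<bullet> u = 0" "z \<bullet> v = 0"
  shows "hopf z \<bullet> cross3 (hopf_deriv z u) (hopf_deriv z v) = quarter_turn u \<bullet> v"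
proof -
  let ?w = "4 *\<^sub>R hopf z" and ?u = "2 *\<^sub>R hopf_deriv z u" and ?v = "2 *\<^sub>R hopf_deriv z v"
  have w: "?w $ 1 = 2 * (fst z $ 1 * fst z $ 2 + snd z $ 1 * snd z $ 2)"
      "?w $ 2 = 2 * (fst z $ 1 * snd z $ 2 - fst z $ 2 * snd z $ 1)"
      "?w $ 3 = fst z $ 1 * fst z $ 1 + snd z $ 1 * snd z $ 1 - fst z $ 2 * fst z $ 2 - snd z $ 2 * snd z $ 2"
    by (simp_all add: hopf_def split_def power2_eq_square)
  have d: "(2 *\<^sub>R hopf_deriv z x) $ 1 =
        fst x $ 1 * fst z $ 2 + fst z $ 1 * fst x $ 2 + snd x $ 1 * snd z $ 2 + snd z $ 1 * snd x $ 2"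
      "(2 *\<^sub>R hopf_deriv z x) $ 2 =
        fst x $ 1 * snd z $ 2 + fst z $ 1 * snd x $ 2 - fst x $ 2 * snd z $ 1 - fst z $ 2 * snd x $ 1"
      "(2 *\<^sub>R hopf_deriv z x) $ 3 =
        fst z $ 1 * fst x $ 1 + snd z $ 1 * snd x $ 1 - fst z $ 2 * fst x $ 2 - snd z $ 2 * snd x $ 2" for x
    by (simp_all add: hopf_deriv_def split_def)
  have "16 * (hopf z \<bullet> cross3 (hopf_deriv z u) (hopf_deriv z v)) = ?w \<bullet> cross3 ?u ?v"
    by (simp add: cross_mult_left cross_mult_right)
  also have "\<dots> = (z \<bullet> z) *
     ((z \<bullet> z) * (quarter_turn u \<bullet> v) - (z \<bullet> u) * (quarter_turn z \<bullet> v) + (z \<bullet> v) * (quarter_turn z \<bullet> u))"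
    unfolding inner_vec_def[of ?w] sum_3 cross_components w d inner_prod_def inner_vec_def sum_2 quarter_turn_def
    by (simp add: algebra_simps)
  finally have "16 * (hopf z \<bullet> cross3 (hopf_deriv z u) (hopf_deriv z v)) = (z \<bullet> z) *
     ((z \<bullet> z) * (quarter_turn u \<bullet> v) - (z \<bullet> u) * (quarter_turn z \<bullet> v) + (z \<bullet> v) * (quarter_turn z \<bullet> u))" .
  then show ?thesis
    using assms by simp
qed

lemma linear_circle_action: "linear (circle_action \<theta>)"
  by (rule linearI) (simp_all add: circle_action_def linear_add[OF linear_quarter_turn]
      linear_cmul[OF linear_quarter_turn] algebra_simps)

lemma circle_action_inverse: "circle_action (- \<theta>) (circle_action \<theta> z) = z"
proof -
  have "circle_action (- \<theta>) (circle_action \<theta> z) = (cos \<theta> * cos \<theta>) *\<^sub>R z + (sin \<theta> * sin \<theta>) *\<^sub>R z"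
    by (simp add: circle_action_def linear_add[OF linear_quarter_turn] linear_cmul[OF linear_quarter_turn]
        quarter_turn_quarter_turn algebra_simps)
  also have "\<dots> = ((cos \<theta>)\<^sup>2 + (sin \<theta>)\<^sup>2) *\<^sub>R z"
    by (simp only: scaleR_left_distrib power2_eq_square)
  finally show ?thesis
    by simp
qed

lemma circle_action_has_vector_derivative:
  "((\<lambda>\<theta>. circle_action \<theta> z) has_vector_derivative quarter_turn z) (at 0)"
proof -
  have "((\<lambda>\<theta>. cos \<theta> *\<^sub>R z + sin \<theta> *\<^sub>R quarter_turn z) has_vector_derivative
      (cos 0 *\<^sub>R 0 + (- sin 0) *\<^sub>R z) + (sin 0 *\<^sub>R 0 + cos 0 *\<^sub>R quarter_turn z)) (at 0)"
    by (intro has_vector_derivative_add has_vector_derivative_scaleR DERIV_cos DERIV_sin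
        has_vector_derivative_const)
  then show ?thesis
    by (simp add: circle_action_def[abs_def])
qed

text \<open>The spinor on the left is, up to scale, the projection of \<open>z0\<close> to the line of spinors over \<open>u\<close>:
  \<open>norm u\<close> plus the action of \<open>u\<close> is twice \<open>norm u\<close> times the spectral projection of that Pauli
  matrix.\<close>

lemma hopf_section_eq:
  assumes "hopf z0 = w0" "norm w0 = 1"
  shows "hopf (norm u *\<^sub>R z0 + 2 *\<^sub>R hopf_adjoint z0 u) = (2 * (norm u + u \<bullet> w0)) *\<^sub>R u"
proof -
  have z0: "z0 \<bullet> z0 = 4"
    using norm_hopf[of z0] assms by (simp add: power2_norm_eq_inner)
  have "hopf (norm u *\<^sub>R z0 + 2 *\<^sub>R hopf_adjoint z0 u) =
      (u \<bullet> u) *\<^sub>R w0 + (2 * norm u) *\<^sub>R hopf_deriv z0 (hopf_adjoint z0 u) + 4 *\<^sub>R hopf (hopf_adjoint z0 u)"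
    by (simp add: hopf_add hopf_scaleR assms(1) power2_norm_eq_inner
        bounded_bilinear.scaleR_left[OF bounded_bilinear_hopf_deriv]
        bounded_bilinear.scaleR_right[OF bounded_bilinear_hopf_deriv])
  also have "\<dots> = (2 * (norm u + u \<bullet> w0)) *\<^sub>R u"
    unfolding hopf_adjoint_reflection hopf_deriv_adjoint z0 assms(1) by (simp add: algebra_simps)
  finally show ?thesis .
qed

text \<open>Normalizing the projected spinor works wherever \<open>u\<close> is not a negative multiple of \<open>w0\<close>. The
  section is defined on an open set of the ambient space, so \<open>hopf\<close> composed with it has the
  identity as its full derivative.\<close>

lemma hopf_local_section:
  assumes w0: "hopf z0 = w0" "norm w0 = 1"
  obtains \<sigma> D U where "open U" "w0 \<in> U" "(\<sigma> has_derivative D) (at w0)" "\<forall>u\<in>U. hopf (\<sigma> u) = u"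
proof -
  define c where "c u = 2 * (norm u + u \<bullet> w0)" for u
  define \<sigma> where "\<sigma> u = inverse (sqrt (c u)) *\<^sub>R (norm u *\<^sub>R z0 + 2 *\<^sub>R hopf_adjoint z0 u)" for u
  let ?U = "{u. 0 < c u}"
  have "c w0 = 4"
    using w0(2) by (simp add: c_def power2_norm_eq_inner[symmetric])
  have "w0 \<noteq> 0"
    using w0(2) by auto
  have norm': "(norm has_derivative (\<lambda>v. v \<bullet> sgn w0)) (at w0)"
    using has_derivative_norm[OF \<open>w0 \<noteq> 0\<close>] by simp
  have c': "(c has_derivative (\<lambda>v. 2 * (v \<bullet> sgn w0 + v \<bullet> w0))) (at w0)"
    unfolding c_def[abs_def]
    by (intro has_derivative_mult_right has_derivative_add norm' has_derivative_inner_left has_derivative_ident)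
  have "((\<lambda>x. inverse (sqrt x)) has_field_derivative
      - (inverse (sqrt (c w0)) * (inverse (sqrt (c w0)) / 2) * inverse (sqrt (c w0)))) (at (c w0))"
    using \<open>c w0 = 4\<close> by (auto intro!: derivative_eq_intros simp: field_simps)
  then have "(\<lambda>u. inverse (sqrt (c u))) differentiable at w0"
    using has_derivative_compose[OF c'] unfolding has_field_derivative_def differentiable_def by blast
  moreover have "(\<lambda>u. norm u *\<^sub>R z0 + 2 *\<^sub>R hopf_adjoint z0 u) differentiable at w0"
    unfolding differentiable_def
    by (rule exI[of _ "\<lambda>v. (v \<bullet> sgn w0) *\<^sub>R z0 + 2 *\<^sub>R hopf_adjoint z0 v"]) (intro has_derivative_add has_derivative_scaleR_left norm' has_derivative_scaleR_right
        linear_imp_has_derivative linear_hopf_adjoint)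
  ultimately have "\<sigma> differentiable at w0"
    unfolding \<sigma>_def[abs_def] by (rule differentiable_scaleR)
  then obtain D where "(\<sigma> has_derivative D) (at w0)"
    unfolding differentiable_def by blast
  moreover have "open ?U"
    unfolding c_def by (intro open_Collect_less continuous_intros)
  moreover have "\<forall>u\<in>?U. hopf (\<sigma> u) = u"
  proof
    fix u assume "u \<in> ?U"
    then have "0 < c u"
      by simp
    have "hopf (\<sigma> u) = (inverse (sqrt (c u)))\<^sup>2 *\<^sub>R (c u *\<^sub>R u)"
      unfolding \<sigma>_def hopf_scaleR hopf_section_eq[OF w0] c_def ..
    then show "hopf (\<sigma> u) = u"
      using \<open>0 < c u\<close> by (simp add: power_inverse)
  qed
  ultimately show ?thesis
    using that[of ?U \<sigma> D] \<open>c w0 = 4\<close> by simp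
qed

text \<open>The north pole has an explicit preimage, and the normalized projected spinor over it gives
  preimages of all points except the south pole, which is treated separately.\<close>

lemma hopf_surj_sphere:
  assumes "norm w = 1"
  obtains z where "hopf z = w"
proof -
  let ?n = "(vector [2, 0], 0) :: cotangent_plane"
  define e :: "real^3" where "e = vector [0, 0, 1]"
  have n: "hopf ?n = e"
    by (simp add: e_def hopf_def vec_eq_iff forall_3)
  have e: "norm e = 1"
    by (simp add: e_def norm_eq_sqrt_inner inner_vec_def sum_3)
  show ?thesis
  proof (cases "w \<bullet> e = -1")
    case True
    have "(w + e) \<bullet> (w + e) = (norm w)\<^sup>2 + 2 * (w \<bullet> e) + (norm e)\<^sup>2"
      by (simp add: power2_norm_eq_inner algebra_simps inner_commute)
    then have "w + e = 0"
      unfolding True assms e by simp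
    then have "w = - e"
      by (simp add: eq_neg_iff_add_eq_0)
    also have "\<dots> = hopf (vector [0, 2], 0)"
      by (simp add: e_def hopf_def vec_eq_iff forall_3)
    finally show ?thesis
      using that by simp
  next
    case False
    have "\<bar>w \<bullet> e\<bar> \<le> 1"
      using Cauchy_Schwarz_ineq2[of w e] assms e by simp
    then have "-1 \<le> w \<bullet> e"
      by linarith
    then have "-1 < w \<bullet> e"
      using False by (metis less_le)
    then have pos: "0 < 2 * (1 + w \<bullet> e)"
      by simp
    have "hopf (inverse (sqrt (2 * (1 + w \<bullet> e))) *\<^sub>R (norm w *\<^sub>R ?n + 2 *\<^sub>R hopf_adjoint ?n w)) = w"
      unfolding hopf_scaleR hopf_section_eq[OF n e] using pos assms by (simp add: power_inverse)
    then show ?thesis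
      by (rule that)
  qed
qed

section \<open>Hamiltonian fields on the cotangent bundle and on the sphere\<close>

lemma grad_hopf_compose:
  assumes "smooth_on UNIV H"
  shows "grad (H \<circ> hopf) z = hopf_adjoint z (grad H (hopf z))"
proof -
  have "(H \<circ> hopf has_derivative (\<bullet>) (grad H (hopf z)) \<circ> hopf_deriv z) (at z)"
    by (rule diff_chain_at[OF hopf_has_derivative smooth_has_derivative_grad[OF assms]])
  then have "grad (H \<circ> hopf) z \<bullet> v = hopf_adjoint z (grad H (hopf z)) \<bullet> v" for v
    unfolding inner_hopf_adjoint by (simp add: grad_inner)
  then show ?thesis
    using vector_eq_rdot by blast
qed

lemma canonical_field_eq: "canonical_field K z = quarter_turn (grad K z)"
  by (simp add: canonical_field_def quarter_turn_def)

lemma hopf_deriv_canonical_field: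
  assumes "smooth_on UNIV H"
  shows "hopf_deriv z (canonical_field (H \<circ> hopf) z) = cross3 (hopf z) (grad H (hopf z))"
  unfolding canonical_field_eq grad_hopf_compose[OF assms] by (rule hopf_deriv_quarter_turn_adjoint)

text \<open>The gradient of \<open>H\<close> enters at \<open>hopf z\<close> only, which is constant along the orbit; the remaining
  dependence on \<open>z\<close> is linear and commutes with multiplication by \<open>i\<close>.\<close>

lemma canonical_field_circle_action:
  assumes "smooth_on UNIV H"
  shows "canonical_field (H \<circ> hopf) (circle_action \<theta> z) = circle_action \<theta> (canonical_field (H \<circ> hopf) z)"
proof -
  have "hopf_adjoint (circle_action \<theta> z) g = circle_action \<theta> (hopf_adjoint z g)" for g
    unfolding circle_action_def by (simp add: coordinates algebra_simps)
  then show ?thesis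
    unfolding canonical_field_eq grad_hopf_compose[OF assms] hopf_circle_action
    by (simp add: circle_action_def linear_add[OF linear_quarter_turn] linear_cmul[OF linear_quarter_turn])
qed

lemma Ck_on_canonical_field:
  assumes "smooth_on UNIV K"
  shows "Ck_on k UNIV (canonical_field K)"
  unfolding canonical_field_eq[abs_def]
  by (rule Ck_on_bounded_linear_compose[OF _ smooth_Ck_grad[OF assms]])
    (use linear_quarter_turn in \<open>simp add: linear_conv_bounded_linear\<close>)

lemma symplectic_form_quarter_turn: "symplectic_form (\<lambda>u v. quarter_turn u \<bullet> v)"
proof -
  have "bilinear (\<lambda>u v. quarter_turn u \<bullet> v)"
    unfolding bilinear_def
    by (intro conjI allI linearI) (simp_all add: linear_add[OF linear_quarter_turn]
        linear_cmul[OF linear_quarter_turn] inner_add_left inner_add_right)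
  moreover have "quarter_turn u \<bullet> u = 0" for u
    using inner_quarter_turn_skew[of u u] by (simp add: inner_commute)
  moreover have "u = 0" if "\<forall>v. quarter_turn u \<bullet> v = 0" for u
    using that[rule_format, of "quarter_turn u"] by (simp add: inner_quarter_turn)
  ultimately show ?thesis
    unfolding symplectic_form_def by blast
qed

lemma hamiltonian_field_canonical:
  assumes "smooth_on UNIV K"
  shows "hamiltonian_field (\<lambda>u v. quarter_turn u \<bullet> v) K (canonical_field K)"
  unfolding hamiltonian_field_def canonical_field_eq inner_quarter_turn
  using smooth_has_derivative_grad[OF assms] by (simp add: inner_commute)

text \<open>The difference of the two gradients at \<open>w\<close> is orthogonal to every tangent vector, as the
  derivative of \<open>H - G\<close> along great circles, where it vanishes. So it is a multiple of \<open>w\<close> and is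
  annihilated by the cross product with \<open>w\<close>.\<close>

lemma cross3_grad_eq_on_sphere:
  assumes H: "smooth_on UNIV H" "smooth_on UNIV G" and eq: "\<And>u. u \<in> S2 \<Longrightarrow> H u = G u" and w: "w \<in> S2"
  shows "cross3 w (grad H w) = cross3 w (grad G w)"
proof -
  let ?g = "grad H w - grad G w"
  have tangent: "?g \<bullet> v = 0" if v: "v \<bullet> w = 0" "norm v = 1" for v
  proof -
    define \<gamma> where "\<gamma> t = cos t *\<^sub>R w + sin t *\<^sub>R v" for t
    have "\<gamma> t \<in> S2" for t
    proof -
      have "\<gamma> t \<bullet> \<gamma> t = (cos t)\<^sup>2 * (w \<bullet> w) + (sin t)\<^sup>2 * (v \<bullet> v)"
        using v(1) by (simp add: \<gamma>_def algebra_simps inner_commute[of w v] power2_eq_square)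
      also have "\<dots> = 1"
        using v(2) w by (simp add: power2_norm_eq_inner[symmetric])
      finally show ?thesis
        by (simp add: norm_eq_sqrt_inner)
    qed
    then have zero: "H (\<gamma> t) - G (\<gamma> t) = 0" for t
      using eq by simp
    have "(\<gamma> has_vector_derivative (cos 0 *\<^sub>R 0 + (- sin 0) *\<^sub>R w) + (sin 0 *\<^sub>R 0 + cos 0 *\<^sub>R v)) (at 0)"
      unfolding \<gamma>_def[abs_def]
      by (intro has_vector_derivative_add has_vector_derivative_scaleR DERIV_cos DERIV_sin
          has_vector_derivative_const)
    then have "(\<gamma> has_derivative (\<lambda>t. t *\<^sub>R v)) (at 0)"
      by (simp add: has_vector_derivative_def)
    moreover have "((\<lambda>u. H u - G u) has_derivative (\<lambda>x. grad H w \<bullet> x - grad G w \<bullet> x)) (at (\<gamma> 0))"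
      using smooth_has_derivative_grad[OF H(1)] smooth_has_derivative_grad[OF H(2)]
      by (intro has_derivative_diff) (simp_all add: \<gamma>_def)
    ultimately have "((\<lambda>t. H (\<gamma> t) - G (\<gamma> t)) has_derivative
        (\<lambda>t. grad H w \<bullet> (t *\<^sub>R v) - grad G w \<bullet> (t *\<^sub>R v))) (at 0)"
      by (rule has_derivative_compose)
    moreover have "((\<lambda>t. H (\<gamma> t) - G (\<gamma> t)) has_derivative (\<lambda>t. 0)) (at (0 :: real))"
      unfolding zero by simp
    ultimately have "(\<lambda>t. grad H w \<bullet> (t *\<^sub>R v) - grad G w \<bullet> (t *\<^sub>R v)) = (\<lambda>t. 0)"
      by (rule has_derivative_unique)
    from fun_cong[OF this, of 1] show ?thesis
      by (simp add: inner_diff_left)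
  qed
  have "cross3 w ?g \<bullet> e = 0" for e
  proof -
    let ?u = "cross3 e w"
    have "cross3 w ?g \<bullet> e = ?g \<bullet> ?u"
      by (simp add: cross3_simps)
    also have "\<dots> = 0"
    proof (cases "?u = 0")
      case False
      have "(inverse (norm ?u) *\<^sub>R ?u) \<bullet> w = 0" "norm (inverse (norm ?u) *\<^sub>R ?u) = 1"
        using False by (simp_all add: dot_cross_self)
      from tangent[OF this] False show ?thesis
        by simp
    qed simp
    finally show ?thesis .
  qed
  then have "cross3 w ?g = 0"
    using inner_eq_zero_iff by blast
  then show ?thesis
    using cross_add_right[of w "grad H w" "- grad G w"] by simp
qed

lemma hamiltonian_field_S2_eq:
  assumes "extends_S2 H f" "w \<in> S2"
  shows "hamiltonian_field_S2 f w = cross3 w (grad H w)"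
  unfolding hamiltonian_field_S2_def
proof (rule the_equality)
  fix v assume "\<exists>G. extends_S2 G f \<and> v = cross3 w (grad G w)"
  then obtain G where G: "extends_S2 G f" "v = cross3 w (grad G w)"
    by blast
  have "G u = H u" if "u \<in> S2" for u
    using G(1) assms(1) that unfolding extends_S2_def by metis
  then show "v = cross3 w (grad H w)"
    unfolding G(2) using G(1) assms unfolding extends_S2_def
    by (intro cross3_grad_eq_on_sphere) blast+
qed (use assms in blast)

section \<open>Conservation of the norm\<close>

text \<open>Noether's argument: the derivative of \<open>1/2 \<bar>z\<bar>\<^sup>2\<close> is \<open>v \<mapsto> - \<omega> (J z) v\<close> with \<open>\<omega> u v = J u \<bullet> v\<close>.
  Differentiating the equivariance in \<open>\<theta>\<close> gives \<open>D (J z) = J (F z)\<close>, so that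
  \<open>\<omega> (J (F z)) (D v) = \<omega> (D (J z)) (D v) = \<omega> (J z) v\<close>.\<close>

lemma symplectic_equivariant_preserves_norm:
  assumes D: "(F has_derivative D) (at z)"
    and symplectic: "\<And>u v. quarter_turn (D u) \<bullet> D v = quarter_turn u \<bullet> v"
    and equivariant: "\<And>\<theta>. F (circle_action \<theta> z) = circle_action \<theta> (F z)"
  shows "F z \<bullet> D v = z \<bullet> v"
proof -
  have "circle_action 0 z = z"
    by (simp add: circle_action_def)
  then have "(F has_derivative D) (at (circle_action 0 z))"
    using D by simp
  then have "((\<lambda>\<theta>. F (circle_action \<theta> z)) has_derivative (\<lambda>t. D (t *\<^sub>R quarter_turn z))) (at 0)"
    using circle_action_has_vector_derivative[of z] unfolding has_vector_derivative_def
    by (rule has_derivative_compose[rotated])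
  then have "((\<lambda>\<theta>. circle_action \<theta> (F z)) has_vector_derivative D (quarter_turn z)) (at 0)"
    unfolding equivariant has_vector_derivative_def
    by (simp add: linear_cmul[OF has_derivative_linear[OF D]])
  then have "D (quarter_turn z) = quarter_turn (F z)"
    using circle_action_has_vector_derivative vector_derivative_unique_at by blast
  then have "quarter_turn (quarter_turn (F z)) \<bullet> D v = quarter_turn (quarter_turn z) \<bullet> v"
    using symplectic[of "quarter_turn z" v] by simp
  then show ?thesis
    by (simp add: quarter_turn_quarter_turn)
qed

lemma rk_map_circle_action:
  fixes A :: "real^'s^'s::finite"
  assumes H: "smooth_on UNIV H" and z: "z \<in> rk_domain A (canonical_field (H \<circ> hopf)) h"
  shows "rk_map A b (canonical_field (H \<circ> hopf)) h (circle_action \<theta> z) =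
    circle_action \<theta> (rk_map A b (canonical_field (H \<circ> hopf)) h z)"
proof (rule rk_map_equivariant[OF _ linear_circle_action linear_circle_action _ _ _ z])
  show "Ck_on 1 UNIV (canonical_field (H \<circ> hopf))"
    by (intro Ck_on_canonical_field smooth_on_compose smooth_on_hopf H)
  show "canonical_field (H \<circ> hopf) (circle_action \<theta> x) = circle_action \<theta> (canonical_field (H \<circ> hopf) x)" for x
    by (rule canonical_field_circle_action[OF H])
  show "circle_action (- \<theta>) (circle_action \<theta> x) = x" for x
    by (rule circle_action_inverse)
  show "circle_action \<theta> (circle_action (- \<theta>) x) = x" for x
    using circle_action_inverse[of "- \<theta>" x] by simp
qed

lemma rk_map_hopf_derivative:
  fixes A :: "real^'s^'s::finite"
  assumes H: "smooth_on UNIV H" and rk: "symplectic_rk TYPE(cotangent_plane) A b"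
    and z: "z \<in> rk_domain A (canonical_field (H \<circ> hopf)) h"
  shows "\<exists>D. (rk_map A b (canonical_field (H \<circ> hopf)) h has_derivative D) (at z) \<and>
    (\<forall>u v. quarter_turn (D u) \<bullet> D v = quarter_turn u \<bullet> v) \<and>
    (\<forall>v. rk_map A b (canonical_field (H \<circ> hopf)) h z \<bullet> D v = z \<bullet> v)"
proof -
  have K: "smooth_on UNIV (H \<circ> hopf)"
    by (rule smooth_on_compose[OF smooth_on_hopf H])
  obtain D where D: "(rk_map A b (canonical_field (H \<circ> hopf)) h has_derivative D) (at z)"
    and symplectic: "\<forall>u v. quarter_turn (D u) \<bullet> D v = quarter_turn u \<bullet> v"
    using rk[unfolded symplectic_rk_def, rule_format, OF _ z,
        of "\<lambda>u v. quarter_turn u \<bullet> v" "H \<circ> hopf"]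
      symplectic_form_quarter_turn K hamiltonian_field_canonical[OF K] by blast
  have "rk_map A b (canonical_field (H \<circ> hopf)) h z \<bullet> D v = z \<bullet> v" for v
    by (rule symplectic_equivariant_preserves_norm[OF D])
      (use symplectic rk_map_circle_action[OF H z] in auto)
  with D symplectic show ?thesis
    by blast
qed

text \<open>The difference \<open>\<bar>F x\<bar>\<^sup>2 - \<bar>x\<bar>\<^sup>2\<close> has derivative \<open>0\<close> on the ball. Its value at the centre is \<open>0\<close>,
  since \<open>F\<close> commutes with the half turn \<open>x \<mapsto> - x\<close> and hence fixes \<open>0\<close>.\<close>

lemma rk_map_hopf_norm:
  fixes A :: "real^'s^'s::finite"
  assumes H: "smooth_on UNIV H" and rk: "symplectic_rk TYPE(cotangent_plane) A b"
    and dom: "cball 0 r \<subseteq> rk_domain A (canonical_field (H \<circ> hopf)) h"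
    and z: "z \<in> cball 0 r"
  shows "norm (rk_map A b (canonical_field (H \<circ> hopf)) h z) = norm z"
proof -
  let ?F = "rk_map A b (canonical_field (H \<circ> hopf)) h"
  have zero: "0 \<in> cball (0 :: cotangent_plane) r"
    using order_trans[OF norm_ge_zero[of z]] z by simp
  have "0 \<in> rk_domain A (canonical_field (H \<circ> hopf)) h"
    using dom zero by blast
  then have "?F (circle_action pi 0) = circle_action pi (?F 0)"
    by (rule rk_map_circle_action[OF H])
  moreover have half_turn: "circle_action pi x = - x" for x
    by (simp add: circle_action_def)
  ultimately have "?F (- 0) = - ?F 0"
    unfolding half_turn by blast
  then have "?F 0 = - ?F 0"
    by simp
  then have "2 *\<^sub>R ?F 0 = 0"
    by (metis add.right_inverse scaleR_2)
  then have "?F 0 = 0"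
    by simp
  have "((\<lambda>x. ?F x \<bullet> ?F x - x \<bullet> x) has_derivative (\<lambda>v. 0)) (at x within cball 0 r)"
    if "x \<in> cball 0 r" for x
  proof -
    have "x \<in> rk_domain A (canonical_field (H \<circ> hopf)) h"
      using that dom by blast
    then obtain D where D: "(?F has_derivative D) (at x)" "\<forall>v. ?F x \<bullet> D v = x \<bullet> v"
      using rk_map_hopf_derivative[OF H rk] by blast
    have "((\<lambda>x. ?F x \<bullet> ?F x - x \<bullet> x) has_derivative
        (\<lambda>v. (?F x \<bullet> D v + D v \<bullet> ?F x) - (x \<bullet> v + v \<bullet> x))) (at x)"
      by (intro has_derivative_diff has_derivative_inner D(1) has_derivative_ident)
    then show ?thesis
      using D(2) by (simp add: inner_commute[of "D _"] inner_commute[of _ x] has_derivative_at_withinI)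
  qed
  from has_derivative_zero_unique[OF convex_cball this z zero]
  have "?F z \<bullet> ?F z = z \<bullet> z"
    using \<open>?F 0 = 0\<close> by simp
  then show ?thesis
    by (simp add: norm_eq_sqrt_inner)
qed

section \<open>The induced map on the sphere\<close>

lemma hopf_vimage_cball: "hopf -` cball 0 1 = cball 0 2"
proof -
  have "norm z \<le> 2 \<longleftrightarrow> (norm z)\<^sup>2 \<le> 2\<^sup>2" for z :: cotangent_plane
    by (metis abs_norm_cancel abs_numeral power2_le_iff_abs_le real_sqrt_abs real_sqrt_le_iff)
  then show ?thesis
    by (auto simp: norm_hopf)
qed

lemma hopf_in_S2: "hopf z \<in> S2 \<longleftrightarrow> z \<bullet> z = 4"
  by (simp add: norm_hopf power2_norm_eq_inner)

text \<open>Near \<open>w\<close> the map \<open>g\<close> is \<open>hopf \<circ> F \<circ> \<sigma>\<close> with a local section \<open>\<sigma>\<close> of \<open>hopf\<close>. Tangent vectors of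
  \<open>S2\<close> lift to tangent vectors of the sphere of radius \<open>2\<close>, and by hypothesis \<open>D\<close> maps these to
  tangent vectors at \<open>F z\<close>. So the area form can be replaced by the symplectic form on both sides.\<close>

lemma volume_preserving_S2_quotient:
  assumes F: "\<And>z. hopf z \<in> S2 \<Longrightarrow> \<exists>D. (F has_derivative D) (at z) \<and>
      (\<forall>u v. quarter_turn (D u) \<bullet> D v = quarter_turn u \<bullet> v) \<and> (\<forall>v. F z \<bullet> D v = z \<bullet> v)"
    and norm: "\<And>z. hopf z \<in> S2 \<Longrightarrow> norm (F z) = norm z"
    and g: "\<And>z. hopf z \<in> S2 \<Longrightarrow> g (hopf z) = hopf (F z)"
  shows "volume_preserving_S2 g"
  unfolding volume_preserving_S2_def
proof
  fix w :: "real^3" assume w: "w \<in> S2"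
  then have "norm w = 1"
    by simp
  then obtain z0 where z0: "hopf z0 = w"
    by (rule hopf_surj_sphere)
  obtain \<sigma> E U where U: "open U" "w \<in> U" and E: "(\<sigma> has_derivative E) (at w)"
    and \<sigma>: "\<forall>u\<in>U. hopf (\<sigma> u) = u"
    by (rule hopf_local_section[OF z0 \<open>norm w = 1\<close>])
  define z where "z = \<sigma> w"
  have z: "hopf z = w"
    using \<sigma> U(2) by (simp add: z_def)
  then have "z \<bullet> z = 4"
    using w hopf_in_S2 by blast
  have "F z \<bullet> F z = z \<bullet> z"
    using norm[of z] z w unfolding power2_norm_eq_inner[symmetric] by simp
  then have Fz: "F z \<bullet> F z = 4"
    using \<open>z \<bullet> z = 4\<close> by simp
  obtain D where D: "(F has_derivative D) (at z)"
    and symplectic: "\<forall>u v. quarter_turn (D u) \<bullet> D v = quarter_turn u \<bullet> v"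
    and moment: "\<forall>v. F z \<bullet> D v = z \<bullet> v"
    using F[of z] z w by blast
  have "((\<lambda>u. hopf (\<sigma> u)) has_derivative (\<lambda>v. hopf_deriv z (E v))) (at w)"
    using has_derivative_compose[OF E hopf_has_derivative] unfolding z_def .
  then have "((\<lambda>u. u) has_derivative (\<lambda>v. hopf_deriv z (E v))) (at w)"
    by (rule has_derivative_transform_within_open[OF _ U]) (use \<sigma> in blast)
  then have lift: "hopf_deriv z (E v) = v" for v
    using has_derivative_unique[OF has_derivative_ident] by metis
  have tangent: "z \<bullet> E u = 0" if "u \<bullet> w = 0" for u
    using inner_hopf_deriv[of z "E u"] that \<open>z \<bullet> z = 4\<close>
    unfolding lift z by (simp add: inner_commute)
  let ?G = "\<lambda>v. hopf_deriv (F z) (D (E v))"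
  have "((\<lambda>u. F (\<sigma> u)) has_derivative (\<lambda>v. D (E v))) (at w)"
    using has_derivative_compose[OF E D[unfolded z_def]] .
  from has_derivative_compose[OF this hopf_has_derivative]
  have G: "((\<lambda>u. hopf (F (\<sigma> u))) has_derivative ?G) (at w within S2)"
    unfolding z_def by (rule has_derivative_at_withinI)
  obtain d where d: "d > 0" "\<And>u. dist u w < d \<Longrightarrow> u \<in> U"
    using U unfolding open_dist by blast
  have "(g has_derivative ?G) (at w within S2)"
  proof (rule has_derivative_transform_within[OF G d(1) w])
    fix u assume "u \<in> S2" "dist u w < d"
    then show "hopf (F (\<sigma> u)) = g u"
      using g[of "\<sigma> u"] \<sigma> d(2)[of u] by auto
  qed
  moreover have "g w \<bullet> cross3 (?G u) (?G v) = w \<bullet> cross3 u v" if "u \<bullet> w = 0 \<and> v \<bullet> w = 0" for u v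
  proof -
    have uv: "z \<bullet> E u = 0" "z \<bullet> E v = 0"
      using tangent that by auto
    have "g w = hopf (F z)"
      using g[of z] z w by simp
    then have "g w \<bullet> cross3 (?G u) (?G v) = quarter_turn (D (E u)) \<bullet> D (E v)"
      using hopf_area[OF Fz, of "D (E u)" "D (E v)"] moment uv by simp
    also have "\<dots> = hopf z \<bullet> cross3 (hopf_deriv z (E u)) (hopf_deriv z (E v))"
      unfolding hopf_area[OF \<open>z \<bullet> z = 4\<close> uv] by (rule symplectic[rule_format])
    finally show ?thesis
      unfolding lift z .
  qed
  ultimately show "\<exists>D. (g has_derivative D) (at w within S2) \<and>
      (\<forall>u v. u \<bullet> w = 0 \<and> v \<bullet> w = 0 \<longrightarrow> g w \<bullet> cross3 (D u) (D v) = w \<bullet> cross3 u v)"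
    by blast
qed

text \<open>With \<open>\<Phi> h z = z + s\<close>, expand \<open>hopf (z + s) = hopf z + hopf_deriv z s + hopf s\<close>. The linear term
  sends the Hamiltonian field to \<open>hopf z \<times> \<nabla>H (hopf z)\<close>, and the quadratic term is \<open>O(h\<^sup>2)\<close> because
  \<open>s = O(h)\<close>.\<close>

lemma hopf_consistent:
  assumes H: "smooth_on UNIV H"
    and \<Phi>: "\<forall>h z. \<bar>h\<bar> \<le> \<delta> \<longrightarrow> z \<in> cball 0 2 \<longrightarrow>
      norm (\<Phi> h z - (z + h *\<^sub>R canonical_field (H \<circ> hopf) z)) \<le> C * h\<^sup>2"
    and C: "C \<ge> 0"
  obtains C' where "C' \<ge> 0"
    "\<forall>h z. \<bar>h\<bar> \<le> \<delta> \<longrightarrow> z \<in> cball 0 2 \<longrightarrow>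
      norm (hopf (\<Phi> h z) - (hopf z + h *\<^sub>R cross3 (hopf z) (grad H (hopf z)))) \<le> C' * h\<^sup>2"
proof -
  let ?X = "canonical_field (H \<circ> hopf)"
  have "Ck_on 1 UNIV ?X"
    by (intro Ck_on_canonical_field smooth_on_compose smooth_on_hopf H)
  then obtain M L where "M > 0" "L > 0" and M: "\<forall>x\<in>cball 0 2. norm (?X x) \<le> M"
    and "\<forall>x\<in>cball 0 2. \<forall>v. norm (frechet_derivative ?X (at x) v) \<le> L * norm v"
    and "\<forall>x\<in>cball 0 2. \<forall>y\<in>cball 0 2. norm (?X x - ?X y) \<le> L * norm (x - y)"
    by (rule C1_bounds_cball)
  obtain K where K: "K > 0" "\<And>z v. norm (hopf_deriv z v) \<le> norm z * norm v * K"
    using bounded_bilinear.pos_bounded[OF bounded_bilinear_hopf_deriv] by blast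
  let ?C = "2 * C * K + (M + C * \<bar>\<delta>\<bar>)\<^sup>2 / 4"
  show ?thesis
  proof (rule that)
    show "?C \<ge> 0"
      using C K by simp
    show "\<forall>h z. \<bar>h\<bar> \<le> \<delta> \<longrightarrow> z \<in> cball 0 2 \<longrightarrow>
      norm (hopf (\<Phi> h z) - (hopf z + h *\<^sub>R cross3 (hopf z) (grad H (hopf z)))) \<le> ?C * h\<^sup>2"
    proof (intro allI impI)
      fix h :: real and z :: cotangent_plane assume h: "\<bar>h\<bar> \<le> \<delta>" and z: "z \<in> cball 0 2"
      define e where "e = \<Phi> h z - (z + h *\<^sub>R ?X z)"
      have e: "norm e \<le> C * h\<^sup>2"
        using \<Phi> h z unfolding e_def by blast
      let ?s = "h *\<^sub>R ?X z + e"
      have "\<Phi> h z = z + ?s"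
        by (simp add: e_def)
      then have "hopf (\<Phi> h z) - (hopf z + h *\<^sub>R cross3 (hopf z) (grad H (hopf z))) = hopf_deriv z e + hopf ?s"
        by (simp add: hopf_add[of z] bounded_bilinear.add_right[OF bounded_bilinear_hopf_deriv]
            bounded_bilinear.scaleR_right[OF bounded_bilinear_hopf_deriv] hopf_deriv_canonical_field[OF H])
      then have "norm (hopf (\<Phi> h z) - (hopf z + h *\<^sub>R cross3 (hopf z) (grad H (hopf z))))
          \<le> norm (hopf_deriv z e) + norm (hopf ?s)"
        by (metis norm_triangle_ineq)
      moreover have "norm (hopf_deriv z e) \<le> 2 * C * K * h\<^sup>2"
      proof -
        have "norm (hopf_deriv z e) \<le> norm z * norm e * K"
          by (rule K(2))
        also have "\<dots> \<le> 2 * (C * h\<^sup>2) * K"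
          using z e K(1) by (intro mult_right_mono mult_mono) auto
        finally show ?thesis
          by (simp add: mult_ac)
      qed
      moreover have "norm (hopf ?s) \<le> (M + C * \<bar>\<delta>\<bar>)\<^sup>2 / 4 * h\<^sup>2"
      proof -
        have "C * h\<^sup>2 = C * \<bar>h\<bar> * \<bar>h\<bar>"
          by (simp add: power2_eq_square)
        also have "\<dots> \<le> C * \<bar>\<delta>\<bar> * \<bar>h\<bar>"
          using h C by (intro mult_right_mono mult_left_mono) auto
        finally have "norm e \<le> C * \<bar>\<delta>\<bar> * \<bar>h\<bar>"
          using e by linarith
        moreover have "norm (h *\<^sub>R ?X z) \<le> M * \<bar>h\<bar>"
          using M z by (simp add: mult.commute[of M] mult_left_mono)
        ultimately have "norm ?s \<le> M * \<bar>h\<bar> + C * \<bar>\<delta>\<bar> * \<bar>h\<bar>"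
          using norm_triangle_ineq[of "h *\<^sub>R ?X z" e] by linarith
        then have "norm ?s \<le> (M + C * \<bar>\<delta>\<bar>) * \<bar>h\<bar>"
          by (simp add: distrib_right)
        then have "(norm ?s)\<^sup>2 \<le> ((M + C * \<bar>\<delta>\<bar>) * \<bar>h\<bar>)\<^sup>2"
          by (intro power_mono) auto
        then show ?thesis
          unfolding norm_hopf by (simp add: power_mult_distrib)
      qed
      ultimately show "norm (hopf (\<Phi> h z) - (hopf z + h *\<^sub>R cross3 (hopf z) (grad H (hopf z)))) \<le> ?C * h\<^sup>2"
        by (simp add: distrib_right)
    qed
  qed
qed

theorem corollary2p4:
  fixes Hbar H :: "real^3 \<Rightarrow> real"
    and A :: "real^'s^'s::finite"
    and b :: "real^'s"
    and \<phi> :: "real \<Rightarrow> real^3 \<Rightarrow> real^3"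
  assumes "smooth_on_S2 Hbar"
    and "smooth_on UNIV H"
    and "\<forall>w\<in>S2. H w = Hbar w"
    and "(\<Sum>i\<in>UNIV. b $ i) = 1"
    and "symplectic_rk TYPE((real^2) \<times> (real^2)) A b"
    and "\<forall>h. \<forall>z\<in>rk_domain A (canonical_field (H \<circ> hopf)) h.
           \<phi> h (hopf z) = hopf (rk_map A b (canonical_field (H \<circ> hopf)) h z)"
  shows "\<exists>\<phi>bar :: real \<Rightarrow> real^3 \<Rightarrow> real^3.
           (\<forall>\<^sub>F h in nhds 0. admissible_step A H h) \<and>
           (\<forall>h. admissible_step A H h \<longrightarrow>
              (\<forall>w\<in>S2. \<phi>bar h w \<in> S2 \<and> \<phi>bar h w = \<phi> h w) \<and>
              volume_preserving_S2 (\<phi>bar h)) \<and>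
           integrator S2 (hamiltonian_field_S2 Hbar) \<phi>bar"
proof -
  let ?X = "canonical_field (H \<circ> hopf)"
  let ?F = "rk_map A b ?X"
  let ?f = "\<lambda>w. cross3 w (grad H w)"
  note H = assms(2) and rk = assms(5)
  have \<phi>: "\<phi> h (hopf z) = hopf (?F h z)" if "z \<in> rk_domain A ?X h" for h z
    using assms(6) that by blast
  have adm: "admissible_step A H h \<longleftrightarrow> cball 0 2 \<subseteq> rk_domain A ?X h" for h
    unfolding admissible_step_def hopf_vimage_cball ..
  have in_cball: "z \<in> cball 0 2" if "hopf z \<in> S2" for z
    using that by (auto simp flip: hopf_vimage_cball)
  have ext: "extends_S2 H Hbar"
    using assms(2,3) unfolding extends_S2_def by blast
  have X: "Ck_on 1 UNIV ?X"
    by (intro Ck_on_canonical_field smooth_on_compose smooth_on_hopf H)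
  obtain \<delta> C where \<delta>: "\<delta> > 0" and C: "C \<ge> 0" and consistent:
    "\<forall>h z. \<bar>h\<bar> \<le> \<delta> \<longrightarrow> z \<in> cball 0 2 \<longrightarrow>
       z \<in> rk_domain A ?X h \<and> norm (?F h z - (z + h *\<^sub>R ?X z)) \<le> C * h\<^sup>2"
    by (rule rk_map_consistent[OF X _ assms(4), of 2 A]) auto
  have adm_small: "admissible_step A H h" if "\<bar>h\<bar> \<le> \<delta>" for h
    unfolding adm using consistent that by blast
  have "\<forall>\<^sub>F h in nhds 0. admissible_step A H h"
    unfolding eventually_nhds_metric using \<delta> adm_small by (auto intro!: exI[of _ \<delta>])
  moreover have "\<phi> h w \<in> S2" if h: "admissible_step A H h" and w: "w \<in> S2" for h w
  proof -
    have "norm w = 1"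
      using w by simp
    then obtain z where z: "hopf z = w"
      by (rule hopf_surj_sphere)
    then have "norm (?F h z) = norm z" "\<phi> h w = hopf (?F h z)"
      using rk_map_hopf_norm[OF H rk _ in_cball] \<phi> in_cball h w unfolding adm by blast+
    then show ?thesis
      using z w norm_hopf[of z] norm_hopf[of "?F h z"] by simp
  qed
  moreover have "volume_preserving_S2 (\<phi> h)" if h: "admissible_step A H h" for h
  proof (rule volume_preserving_S2_quotient[of "?F h"])
    fix z assume "hopf z \<in> S2"
    then have z: "z \<in> cball 0 2" "z \<in> rk_domain A ?X h"
      using in_cball h unfolding adm by blast+
    show "\<exists>D. (?F h has_derivative D) (at z) \<and>
        (\<forall>u v. quarter_turn (D u) \<bullet> D v = quarter_turn u \<bullet> v) \<and> (\<forall>v. ?F h z \<bullet> D v = z \<bullet> v)"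
      by (rule rk_map_hopf_derivative[OF H rk z(2)])
    show "norm (?F h z) = norm z"
      using rk_map_hopf_norm[OF H rk _ z(1)] h unfolding adm by blast
    show "\<phi> h (hopf z) = hopf (?F h z)"
      by (rule \<phi>[OF z(2)])
  qed
  moreover have "integrator S2 (hamiltonian_field_S2 Hbar) \<phi>"
  proof -
    have "norm (?F h z - (z + h *\<^sub>R ?X z)) \<le> C * h\<^sup>2" if "\<bar>h\<bar> \<le> \<delta>" "z \<in> cball 0 2" for h z
      using consistent that by blast
    then have second_order: "\<forall>h z. \<bar>h\<bar> \<le> \<delta> \<longrightarrow> z \<in> cball 0 2 \<longrightarrow>
        norm (?F h z - (z + h *\<^sub>R ?X z)) \<le> C * h\<^sup>2"
      by blast
    obtain C1 where C1: "C1 \<ge> 0" "\<forall>h z. \<bar>h\<bar> \<le> \<delta> \<longrightarrow> z \<in> cball 0 2 \<longrightarrow>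
        norm (hopf (?F h z) - (hopf z + h *\<^sub>R ?f (hopf z))) \<le> C1 * h\<^sup>2"
      by (rule hopf_consistent[OF H second_order C])
    have "Ck_on 1 UNIV ?f"
      by (rule Ck_on_bilinear[OF bilinear_cross[unfolded bilinear_conv_bounded_bilinear]
            Ck_on_bounded_linear[OF bounded_linear_ident] smooth_Ck_grad[OF H]])
    then obtain \<epsilon> \<psi> C2 where "\<epsilon> > 0" "C2 \<ge> 0"
      and flow: "\<forall>\<delta>. 0 < \<delta> \<and> \<delta> \<le> \<epsilon> \<longrightarrow> flow_on \<delta> S2 ?f \<psi>"
      and C2: "\<forall>h\<in>{-\<epsilon>..\<epsilon>}. \<forall>w\<in>S2. norm (\<psi> h w - (w + h *\<^sub>R ?f w)) \<le> C2 * h\<^sup>2"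
      by (rule flow_on_sphere) (rule dot_cross_self)
    define \<eta> where "\<eta> = min \<delta> \<epsilon>"
    have \<eta>: "\<eta> > 0" "\<eta> \<le> \<delta>" "\<eta> \<le> \<epsilon>"
      using \<delta> \<open>\<epsilon> > 0\<close> by (auto simp: \<eta>_def)
    have "flow_on \<eta> S2 ?f \<psi>"
      using flow \<eta> by blast
    then have "flow_on \<eta> S2 (hamiltonian_field_S2 Hbar) \<psi>"
      unfolding flow_on_def using hamiltonian_field_S2_eq[OF ext] by metis
    moreover have "norm (\<phi> h w - \<psi> h w) \<le> (C1 + C2) * \<bar>h\<bar> ^ (1 + 1)" if h: "h \<in> {-\<eta>..\<eta>}" and w: "w \<in> S2" for h w
    proof -
      have h': "\<bar>h\<bar> \<le> \<delta>" "h \<in> {-\<epsilon>..\<epsilon>}"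
        using h \<eta> by auto
      have "norm w = 1"
        using w by simp
      then obtain z where z: "hopf z = w"
        by (rule hopf_surj_sphere)
      have "z \<in> cball 0 2"
        using in_cball z w by blast
      then have "\<phi> h w = hopf (?F h z)" "norm (hopf (?F h z) - (w + h *\<^sub>R ?f w)) \<le> C1 * h\<^sup>2"
        using \<phi>[of z h] C1(2) consistent h'(1) z by blast+
      then have "norm (\<phi> h w - (w + h *\<^sub>R ?f w)) \<le> C1 * h\<^sup>2"
        by simp
      moreover have "norm (\<psi> h w - (w + h *\<^sub>R ?f w)) \<le> C2 * h\<^sup>2"
        using C2 h'(2) w by blast
      ultimately have "norm ((\<phi> h w - (w + h *\<^sub>R ?f w)) - (\<psi> h w - (w + h *\<^sub>R ?f w))) \<le> C1 * h\<^sup>2 + C2 * h\<^sup>2"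
        by (rule order_trans[OF norm_triangle_ineq4 add_mono])
      then show ?thesis
        by (simp add: distrib_right numeral_2_eq_2[symmetric])
    qed
    ultimately show ?thesis
      unfolding integrator_def using \<eta>(1)
      by (intro exI[of _ 1] conjI exI[of _ \<eta>] exI[of _ \<psi>] exI[of _ "C1 + C2"]) auto
  qed
  ultimately show ?thesis
    by (intro exI[of _ \<phi>]) blast
qed

end
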